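(* Let $G$ be a connected graph. Then $G$ is a $3$-$\chi_{ig}^{A}$-lower-game-vertex-critical graph if and only if one of the following holds: (1) $G=C_3$; (2) $G=C_5$; (3) $G=P_6$; (4) $G=K_{3,3}-\mathcal{M}$, where $\mathcal{M}$ is a perfect matching in $K_{3,3}$; (5) $G=C_4^+$, where $C_4^+$ is the graph obtained from $C_4$ by adding one pendant neighbor to each vertex of $C_4$. Likewise, $G$ is a $3$-$\chi_{ig}^{AB}$-lower-game-vertex-critical graph if and only if one of (1)--(5) holds.
   Context: All graphs are simple, undirected and finite. The independence coloring game on a graph $G$ is played by Alice and Bob in rounds, round $i$ being played with color $i$ ($i=1,2,\ldots$). Within a round the players alternate moves, each move consisting of coloring a previously uncolored vertex with the color of the round so that the vertices colored in the same round form an independent set. A round is completed when no uncolored vertex can be given the color of the round (every uncolored vertex is adjacent to a vertex colored in this round). The game is over when all vertices are colored. Alice wants to finish in as few rounds as possible, Bob in as many rounds as possible. In the A-independence coloring game every round is started by Alice; the number of rounds when both players play optimally is the A-independence game chromatic number $\chi_{ig}^{A}(G)$. In the AB-independence coloring game Alice starts the first round and each further round is started by the player who did not make the last move of the previous round; the number of rounds when both players play optimally is the AB-independence game chromatic number $\chi_{ig}^{AB}(G)$. For $x\in V(G)$, $G-x$ is the graph obtained from $G$ by deleting $x$ and all edges incident with $x$. For $\varphi\in\{\chi_{ig}^{A},\chi_{ig}^{AB}\}$, a graph $G$ is $k$-$\varphi$-lower-game-vertex-critical if $\varphi(G)=k$ and $\varphi(G-x)<\varphi(G)$ for every $x\in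 V(G)$. $P_n$ and $C_n$ denote the path and the cycle of order $n$ (number of vertices), $K_{m,n}$ is the complete bipartite graph, and $K_{n,n}-\mathcal{M}$ is $K_{n,n}$ with the edges of the perfect matching $\mathcal{M}$ removed. A pendant vertex is a vertex of degree $1$. Equality of graphs means isomorphism. *)

theory Defs
  imports "Graph_Theory.Graph_Theory"
begin

text \<open>A finite simple undirected graph is a \<^locale>\<open>graph\<close> of the library, i.e. a finite, symmetric,
  loop-free digraph without parallel arcs; every edge is a pair of opposite arcs.\<close>

section \<open>The independence coloring game\<close>

datatype player = Alice | Bob

fun opponent :: "player \<Rightarrow> player" where
  "opponent Alice = Bob"
| "opponent Bob = Alice"

text \<open>In a position, \<open>U\<close> is the set of uncolored vertices and \<open>C\<close> the set of vertices that have
  received the color of the current round.\<close>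

definition legal_moves :: "('a, 'b) pre_digraph \<Rightarrow> 'a set \<Rightarrow> 'a set \<Rightarrow> 'a set" where
  "legal_moves G U C = {v \<in> U. \<forall>u \<in> C. \<not> u \<rightarrow>\<^bsub>G\<^esub> v}"

text \<open>\<open>rounds_left starter G U C p\<close> is the number of rounds, the current one included, that are
  still completed under optimal play when \<open>p\<close> is to move. When no legal move remains, the round is
  completed and \<open>opponent p\<close> made its last move; \<open>starter\<close> maps the player who made the last move of
  a round to the player who starts the next one. The case of no legal move with \<open>C = {}\<close> means
  \<open>U = {}\<close> at the start of a round: the game is over. Infinite \<open>U\<close> is excluded only to make the
  function total.\<close>

function rounds_left ::
  "(player \<Rightarrow> player) \<Rightarrow> ('a, 'b) pre_digraph \<Rightarrow> 'a set \<Rightarrow> 'a set \<Rightarrow> player \<Rightarrow> nat" where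
  "rounds_left starter G U C p =
    (if infinite U then 0
     else if legal_moves G U C = {} then
       (if C = {} then 0 else Suc (rounds_left starter G U {} (starter (opponent p))))
     else
       (case p of
          Alice \<Rightarrow> Min ((\<lambda>v. rounds_left starter G (U - {v}) (insert v C) Bob) ` legal_moves G U C)
        | Bob \<Rightarrow> Max ((\<lambda>v. rounds_left starter G (U - {v}) (insert v C) Alice) ` legal_moves G U C)))"
  by pat_completeness auto
termination
proof (relation "(\<lambda>(s, G, U, C, p). card U) <*mlex*> measure (\<lambda>(s, G, U, C, p). if C = {} then 0 else 1)",
    goal_cases)
  case 1
  show ?case by (intro wf_mlex wf_measure)
next
  case (2 starter G U C p)
  then show ?case by (auto simp: mlex_prod_def)
next
  case (3 starter G U C p v)
  then have "card (U - {v}) < card U"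
    by (intro psubset_card_mono) (auto simp: legal_moves_def)
  then show ?case by (auto simp: mlex_prod_def)
next
  case (4 starter G U C p v)
  then have "card (U - {v}) < card U"
    by (intro psubset_card_mono) (auto simp: legal_moves_def)
  then show ?case by (auto simp: mlex_prod_def)
qed

declare rounds_left.simps [simp del]

definition chi_igA :: "('a, 'b) pre_digraph \<Rightarrow> nat" where
  "chi_igA G = rounds_left (\<lambda>last. Alice) G (verts G) {} Alice"

definition chi_igAB :: "('a, 'b) pre_digraph \<Rightarrow> nat" where
  "chi_igAB G = rounds_left opponent G (verts G) {} Alice"

definition lower_game_vertex_critical ::
  "nat \<Rightarrow> (('a, 'b) pre_digraph \<Rightarrow> nat) \<Rightarrow> ('a, 'b) pre_digraph \<Rightarrow> bool" where
  "lower_game_vertex_critical k \<phi> G \<longleftrightarrow>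
     \<phi> G = k \<and> (\<forall>x \<in> verts G. \<phi> (pre_digraph.del_vert G x) < \<phi> G)"

section \<open>Particular graphs\<close>

definition path_graph :: "nat \<Rightarrow> nat pair_pre_digraph" where
  "path_graph n =
     (let A = {(i, Suc i) | i. Suc i < n} in \<lparr> pverts = {..<n}, parcs = A \<union> A\<inverse> \<rparr>)"

text \<open>Meaningful for \<open>n \<ge> 3\<close> only.\<close>

definition cycle_graph :: "nat \<Rightarrow> nat pair_pre_digraph" where
  "cycle_graph n =
     (let A = {(i, Suc i mod n) | i. i < n} in \<lparr> pverts = {..<n}, parcs = A \<union> A\<inverse> \<rparr>)"

text \<open>A perfect matching as a set of edges is a symmetric set of arcs.\<close>

definition perfect_matching :: "'a pair_pre_digraph \<Rightarrow> ('a \<times> 'a) set \<Rightarrow> bool" where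
  "perfect_matching G M \<longleftrightarrow> M \<subseteq> parcs G \<and> sym M \<and> (\<forall>v \<in> pverts G. \<exists>!w. (v, w) \<in> M)"

definition remove_edges :: "'a pair_pre_digraph \<Rightarrow> ('a \<times> 'a) set \<Rightarrow> 'a pair_pre_digraph" where
  "remove_edges G M = G\<lparr>parcs := parcs G - M\<rparr>"

text \<open>\<open>Inr v\<close> is the pendant neighbor attached to the original vertex \<open>Inl v\<close>.\<close>

definition add_pendants :: "'a pair_pre_digraph \<Rightarrow> ('a + 'a) pair_pre_digraph" where
  "add_pendants G =
     (let P = {(Inl v, Inr v) | v. v \<in> pverts G} in
      \<lparr> pverts = pverts G <+> pverts G,
        parcs = {(Inl u, Inl v) | u v. (u, v) \<in> parcs G} \<union> P \<union> P\<inverse> \<rparr>)"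

end

(* Every completed round colors a maximal independent set. Hence if G[U] is connected, at most two
   rounds are needed on U exactly when U has a vertex v such that the neighbors and the non-neighbors
   of v are both independent (a dominator): otherwise Bob can answer v with a vertex on the other side
   of the bipartition.

   Let G be critical. If G is not bipartite, deleting any vertex makes it bipartite, and a dominator
   of G - x, for a non-cut vertex x, yields a triangle or a 5-cycle through x, which must be all of G.
   If G is bipartite, for every non-cut vertex x some vertex y of the opposite side is adjacent to
   all of the side of x except x. A minimal component hanging at a cut vertex then contains a
   leaf; chasing the vertices y for leaves and non-cut vertices gives C_4^+ if some leaf is attached
   to a vertex of degree at least 3, and P_6 otherwise. Without cut vertices x and y are matched and
   G is K_{n,n} minus a perfect matching, where Bob, always answering with the matched vertex, forces
   n rounds; so n = 3.

   The converse is a finite check: an opening move of Alice for each of the five graphs and each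
   vertex-deleted subgraph such that every way to complete the first round is good for her. *)

theory Submission
  imports Defs
begin

text \<open>The set left after the first round takes at most one more round exactly when it is
  independent, whoever starts that round. So the bound two depends on the first round alone. This is
  why both games have the same critical graphs and why the argument runs for an arbitrary rule
  \<open>st\<close>. The rule enters only in the mirror strategy, where more than two rounds are
  forced, through \<open>st Bob = Alice\<close>, which both games satisfy.

  The obstacle is that two rounds yield a dominator only on a connected vertex set. For a cut vertex
  x, criticality is used merely to 2-color G - x. Cut vertices are controlled indirectly: a non-cut
  vertex l, typically a leaf, provides a vertex adjacent to one whole side except l. This vertex
  holds the graph together so tightly that removing another vertex of that side can cut off little
  more than a leaf.

  In the classification, deleting x means playing on a smaller vertex set of the same G.\<close>

section \<open>Rounds of the game\<close>

context graph
begin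

lemma adj_sym: "u \<rightarrow> v \<Longrightarrow> v \<rightarrow> u"
  using sym_arcs by (rule arcs_ends_symmetric)

lemma adj_irrefl [simp]: "\<not> u \<rightarrow> u"
  using adj_not_same by blast

definition indep :: "'a set \<Rightarrow> bool" where
  "indep S \<longleftrightarrow> (\<forall>u \<in> S. \<forall>v \<in> S. \<not> u \<rightarrow> v)"

definition max_indep :: "'a set \<Rightarrow> 'a set \<Rightarrow> bool" where
  "max_indep U I \<longleftrightarrow> I \<subseteq> U \<and> indep I \<and> (\<forall>v \<in> U - I. \<exists>u \<in> I. u \<rightarrow> v)"

lemma indep_subset: "indep T \<Longrightarrow> S \<subseteq> T \<Longrightarrow> indep S"
  unfolding indep_def by blast

lemma indep_insert_legal: "indep C \<Longrightarrow> v \<in> legal_moves G U C \<Longrightarrow> indep (insert v C)"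
  unfolding indep_def legal_moves_def by (auto dest: adj_sym)

lemma finite_legal_moves [simp]: "finite U \<Longrightarrow> finite (legal_moves G U C)"
  unfolding legal_moves_def by simp

lemma legal_moves_empty [simp]: "legal_moves G U {} = U"
  unfolding legal_moves_def by simp

lemma rounds_left_Alice_le:
  assumes "finite U" "v \<in> legal_moves G U C"
  shows "rounds_left st G U C Alice \<le> rounds_left st G (U - {v}) (insert v C) Bob"
  using assms by (subst rounds_left.simps) (auto intro: Min_le)

lemma rounds_left_Bob_ge:
  assumes "finite U" "v \<in> legal_moves G U C"
  shows "rounds_left st G (U - {v}) (insert v C) Alice \<le> rounds_left st G U C Bob"
  using assms by (subst (2) rounds_left.simps) (auto intro: Max_ge)

text \<open>A minimum or maximum over a finite nonempty set is attained. This form forgets who is to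
  move, which suffices whenever only the possible outcomes of a round matter.\<close>

lemma rounds_left_move:
  assumes "finite U" "legal_moves G U C \<noteq> {}"
  obtains v q where "v \<in> legal_moves G U C"
    "rounds_left st G U C p = rounds_left st G (U - {v}) (insert v C) q"
proof (cases p)
  case Alice
  let ?f = "\<lambda>v. rounds_left st G (U - {v}) (insert v C) Bob"
  have "rounds_left st G U C p = Min (?f ` legal_moves G U C)"
    using assms Alice by (subst rounds_left.simps) auto
  moreover have "Min (?f ` legal_moves G U C) \<in> ?f ` legal_moves G U C"
    using assms by (intro Min_in) auto
  ultimately show ?thesis using that by auto
next
  case Bob
  let ?f = "\<lambda>v. rounds_left st G (U - {v}) (insert v C) Alice"
  have "rounds_left st G U C p = Max (?f ` legal_moves G U C)"
    using assms Bob by (subst rounds_left.simps) auto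
  moreover have "Max (?f ` legal_moves G U C) \<in> ?f ` legal_moves G U C"
    using assms by (intro Max_in) auto
  ultimately show ?thesis using that by auto
qed

lemma rounds_left_end:
  assumes "finite U" "legal_moves G U C = {}" "C \<noteq> {}"
  shows "rounds_left st G U C p = Suc (rounds_left st G U {} (st (opponent p)))"
  using assms by (subst rounds_left.simps) simp

lemma rounds_left_empty [simp]: "rounds_left st G {} {} p = 0"
  by (subst rounds_left.simps) simp

text \<open>Moves shift vertices from \<open>U\<close> to \<open>C\<close> and keep
  \<open>U \<union> C\<close> and the independence of \<open>C\<close>. When no move is left,
  \<open>C\<close> has become maximal. The induction thus replaces a whole round by one maximal
  independent set.\<close>

lemma rounds_left_round:
  assumes "finite U" "indep C" "U \<union> C \<noteq> {}"
  shows "\<exists>I q. C \<subseteq> I \<and> max_indep (U \<union> C) I \<and>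
    rounds_left st G U C p = Suc (rounds_left st G (U \<union> C - I) {} q)"
  using assms
proof (induction "card U" arbitrary: U C p rule: less_induct)
  case less
  show ?case
  proof (cases "legal_moves G U C = {}")
    case True
    \<comment> \<open>With \<open>C\<close> empty every vertex of \<open>U\<close> would be legal,
      and so would a vertex of \<open>U \<inter> C\<close>, since \<open>C\<close> is
      independent.\<close>
    then have "C \<noteq> {}" "U \<inter> C = {}"
      using less.prems unfolding legal_moves_def indep_def by auto
    then have "U \<union> C - C = U" by blast
    moreover have "max_indep (U \<union> C) C"
      using True less.prems unfolding max_indep_def legal_moves_def by blast
    ultimately show ?thesis
      using rounds_left_end[OF less.prems(1) True \<open>C \<noteq> {}\<close>, of st p]
      by (intro exI[of _ C] exI[of _ "st (opponent p)"]) simp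
  next
    case False
    then obtain v q where v: "v \<in> legal_moves G U C"
      "rounds_left st G U C p = rounds_left st G (U - {v}) (insert v C) q"
      using rounds_left_move[OF less.prems(1) False, of st p] by blast
    then have "v \<in> U" unfolding legal_moves_def by simp
    then have card: "card (U - {v}) < card U" using less.prems(1) by (intro card_Diff1_less)
    have eq: "U - {v} \<union> insert v C = U \<union> C" using \<open>v \<in> U\<close> by blast
    from less.hyps[OF card, of "insert v C" q] less.prems(1) indep_insert_legal[OF less.prems(2) v(1)]
    obtain I r where "insert v C \<subseteq> I" "max_indep (U - {v} \<union> insert v C) I"
      "rounds_left st G (U - {v}) (insert v C) q =
        Suc (rounds_left st G (U - {v} \<union> insert v C - I) {} r)"
      by auto
    then show ?thesis unfolding eq v(2) by (intro exI[of _ I] exI[of _ r]) simp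
  qed
qed

lemma rounds_left_0D: "finite U \<Longrightarrow> rounds_left st G U {} p = 0 \<Longrightarrow> U = {}"
proof -
  assume fin: "finite U" and 0: "rounds_left st G U {} p = 0"
  show "U = {}"
  proof (rule ccontr)
    assume "U \<noteq> {}"
    moreover have "indep {}" unfolding indep_def by simp
    ultimately obtain I q where "rounds_left st G U {} p = Suc (rounds_left st G (U \<union> {} - I) {} q)"
      using rounds_left_round[OF fin, of "{}" st p] by auto
    then show False using 0 by simp
  qed
qed

text \<open>The bound is demanded for every way to complete the round, so no strategy has to be
  described.\<close>

lemma rounds_left_upper:
  assumes "finite U" "indep C"
    and "\<And>I q. C \<subseteq> I \<Longrightarrow> max_indep (U \<union> C) I \<Longrightarrow> rounds_left st G (U \<union> C - I) {} q \<le> k"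
  shows "rounds_left st G U C p \<le> Suc k"
proof (cases "U \<union> C = {}")
  case False
  then obtain I q where "C \<subseteq> I" "max_indep (U \<union> C) I"
    "rounds_left st G U C p = Suc (rounds_left st G (U \<union> C - I) {} q)"
    using rounds_left_round[OF assms(1,2), of st p] by blast
  then show ?thesis using assms(3) by simp
qed auto

lemma rounds_left_le_1:
  assumes "finite U" "indep U" shows "rounds_left st G U {} p \<le> 1"
proof -
  have "rounds_left st G U {} p \<le> Suc 0"
  proof (rule rounds_left_upper)
    fix I q assume "max_indep (U \<union> {}) I"
    then have "U \<union> {} - I = {}" using assms unfolding max_indep_def indep_def by blast
    then show "rounds_left st G (U \<union> {} - I) {} q \<le> 0" by (simp only: rounds_left_empty)
  qed (use assms in \<open>auto simp: indep_def\<close>)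
  then show ?thesis by simp
qed

lemma indep_of_rounds_left_le_1:
  assumes "finite U" "rounds_left st G U {} p \<le> 1" shows "indep U"
proof (cases "U = {}")
  case False
  have "indep {}" unfolding indep_def by simp
  then obtain I q where I: "max_indep (U \<union> {}) I"
    "rounds_left st G U {} p = Suc (rounds_left st G (U \<union> {} - I) {} q)"
    using rounds_left_round[OF assms(1), of "{}" st p] False by auto
  then have "U - I = {}" using assms rounds_left_0D[of "U - I" st q] by simp
  then show ?thesis using I(1) indep_subset unfolding max_indep_def by blast
qed (simp add: indep_def)

text \<open>The finished current color class and what it leaves over are the two classes of a proper
  2-coloring. The vertices of \<open>C\<close> are forced to share a class, which is what Bob
  exploits later.\<close>

lemma split_of_rounds_left_le_2:
  assumes "finite U" "indep C" "rounds_left st G U C p \<le> 2"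
  shows "\<exists>I. C \<subseteq> I \<and> I \<subseteq> U \<union> C \<and> indep I \<and> indep (U \<union> C - I)"
proof (cases "U \<union> C = {}")
  case True
  then show ?thesis by (auto simp: indep_def)
next
  case False
  then obtain I q where I: "C \<subseteq> I" "max_indep (U \<union> C) I"
    "rounds_left st G U C p = Suc (rounds_left st G (U \<union> C - I) {} q)"
    using rounds_left_round[OF assms(1,2), of st p] by blast
  have "finite (U \<union> C - I)" using assms(1) I(1) by (auto intro: finite_subset[of _ U])
  then have "indep (U \<union> C - I)"
    using I assms(3) indep_of_rounds_left_le_1[of "U \<union> C - I" st q] by simp
  then show ?thesis using I unfolding max_indep_def by blast
qed

text \<open>A sufficient form of a winning opening: all completions are allowed, even those with bad
  later moves by Alice.\<close>

definition safe_move :: "'a set \<Rightarrow> 'a \<Rightarrow> bool" where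
  "safe_move U v \<longleftrightarrow> v \<in> U \<and> (\<forall>I. v \<in> I \<longrightarrow> max_indep U I \<longrightarrow> indep (U - I))"

lemma rounds_left_first_move:
  assumes "finite U" "v \<in> U"
    and "\<And>I q. v \<in> I \<Longrightarrow> max_indep U I \<Longrightarrow> rounds_left st G (U - I) {} q \<le> k"
  shows "rounds_left st G U {} Alice \<le> Suc k"
proof -
  have "rounds_left st G U {} Alice \<le> rounds_left st G (U - {v}) {v} Bob"
    using rounds_left_Alice_le[of U v "{}"] assms by simp
  also have "\<dots> \<le> Suc k"
    using assms by (intro rounds_left_upper) (auto simp: indep_def insert_absorb)
  finally show ?thesis .
qed

lemma rounds_left_safe_move:
  assumes "finite U" "safe_move U v"
  shows "rounds_left st G U {} Alice \<le> 2"
  using rounds_left_first_move[of U v st 1] rounds_left_le_1 assms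
  unfolding safe_move_def by (simp add: numeral_2_eq_2)

definition dominator :: "'a set \<Rightarrow> 'a \<Rightarrow> bool" where
  "dominator U v \<longleftrightarrow> v \<in> U \<and> indep {u \<in> U. v \<rightarrow> u} \<and> indep {u \<in> U. \<not> v \<rightarrow> u}"

text \<open>A vertex u left over has a neighbor w in \<open>I\<close>. As w shares a color with v,
  it is not adjacent to v, and the non-neighbors of v are independent. Hence u is a neighbor of v,
  and these are independent too.\<close>

lemma dominator_safe_move: "dominator U v \<Longrightarrow> safe_move U v"
proof -
  assume v: "dominator U v"
  have "U - I \<subseteq> {u \<in> U. v \<rightarrow> u}" if I: "v \<in> I" "max_indep U I" for I
  proof
    fix u assume u: "u \<in> U - I"
    then obtain w where w: "w \<in> I" "w \<rightarrow> u" using I unfolding max_indep_def by blast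
    then have "w \<in> U" "\<not> v \<rightarrow> w" using I unfolding max_indep_def indep_def by auto
    moreover have "indep {u \<in> U. \<not> v \<rightarrow> u}" using v unfolding dominator_def by simp
    ultimately show "u \<in> {u \<in> U. v \<rightarrow> u}" using u w unfolding indep_def by auto
  qed
  moreover have "v \<in> U" "indep {u \<in> U. v \<rightarrow> u}" using v unfolding dominator_def by auto
  ultimately show ?thesis using indep_subset unfolding safe_move_def by auto
qed

section \<open>Connected vertex sets, their bipartitions and the need for a dominator\<close>

definition bipartite :: "'a set \<Rightarrow> bool" where
  "bipartite U \<longleftrightarrow> (\<exists>I \<subseteq> U. indep I \<and> indep (U - I))"

text \<open>Connectivity of the subgraph induced on \<open>U\<close>, stated by closed sets instead
  of walks, so that G - x is just a set difference. The empty set counts as connected.\<close>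

definition conn :: "'a set \<Rightarrow> bool" where
  "conn U \<longleftrightarrow> (\<forall>X \<subseteq> U. X \<noteq> {} \<longrightarrow> (\<forall>u \<in> X. \<forall>v \<in> U. u \<rightarrow> v \<longrightarrow> v \<in> X) \<longrightarrow> X = U)"

lemma connD:
  assumes "conn U" "X \<subseteq> U" "X \<noteq> {}" "\<And>u v. u \<in> X \<Longrightarrow> v \<in> U \<Longrightarrow> u \<rightarrow> v \<Longrightarrow> v \<in> X"
  shows "X = U"
  using assms unfolding conn_def by simp

text \<open>The vertices on which the two colorings agree form a set closed under adjacency, and v
  belongs to it.\<close>

lemma bipartition_unique:
  assumes "conn U" "I \<subseteq> U" "J \<subseteq> U" "indep I" "indep (U - I)" "indep J" "indep (U - J)"
    and "v \<in> I" "v \<in> J"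
  shows "I = J"
proof -
  let ?X = "{u \<in> U. u \<in> I \<longleftrightarrow> u \<in> J}"
  have "\<forall>u \<in> ?X. \<forall>w \<in> U. u \<rightarrow> w \<longrightarrow> w \<in> ?X"
    using assms(4-7) unfolding indep_def by blast
  moreover have "?X \<noteq> {}" using assms by blast
  ultimately have "?X = U" using assms(1) unfolding conn_def by simp
  then show ?thesis using assms(2,3) by blast
qed

lemma bipartite_of_rounds_left_le_2:
  assumes "finite U" "rounds_left st G U {} p \<le> 2" shows "bipartite U"
  using split_of_rounds_left_le_2[of U "{}" st p] assms unfolding bipartite_def
  by (auto simp: indep_def)

text \<open>If a non-neighbor \<open>w\<close> of Alice's first vertex \<open>v\<close> is on the other side of the bipartition,
  Bob plays it, and \<open>v\<close>, \<open>w\<close> cannot have the same color in a proper 2-coloring.\<close>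

lemma dominator_of_rounds_left_le_2:
  assumes "finite U" "U \<noteq> {}" "conn U" "rounds_left st G U {} Alice \<le> 2"
  obtains v where "dominator U v"
proof -
  let ?f = "\<lambda>v. rounds_left st G (U - {v}) (insert v {}) Bob"
  have "rounds_left st G U {} Alice = Min (?f ` legal_moves G U {})"
    using assms by (subst rounds_left.simps) auto
  also have "\<dots> \<in> ?f ` legal_moves G U {}"
    using assms by (intro Min_in) auto
  finally obtain v where v: "v \<in> U" "rounds_left st G (U - {v}) {v} Bob \<le> 2"
    using assms by auto
  have "indep {v}" unfolding indep_def by simp
  have "U - {v} \<union> {v} = U" using v(1) by blast
  with split_of_rounds_left_le_2[OF _ \<open>indep {v}\<close> v(2)] assms(1)
  obtain I where I: "v \<in> I" "I \<subseteq> U" "indep I" "indep (U - I)" by auto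
  have "w \<in> I" if w: "w \<in> U" "\<not> v \<rightarrow> w" for w
  proof (cases "w = v")
    case False
    then have "w \<in> legal_moves G (U - {v}) {v}" using w unfolding legal_moves_def by simp
    then have le: "rounds_left st G (U - {v} - {w}) {w, v} Alice \<le> 2" and "indep {w, v}"
      using rounds_left_Bob_ge[of "U - {v}" w "{v}" st] v(2) assms(1) indep_insert_legal \<open>indep {v}\<close>
      by auto
    have "U - {v} - {w} \<union> {w, v} = U" using v w by blast
    with split_of_rounds_left_le_2[OF _ \<open>indep {w, v}\<close> le] assms(1)
    obtain J where J: "w \<in> J" "v \<in> J" "J \<subseteq> U" "indep J" "indep (U - J)" by auto
    then have "I = J" using bipartition_unique[OF assms(3) I(2) J(3) I(3,4) J(4,5) I(1)] by simp
    then show ?thesis using J by simp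
  qed (use I in simp)
  then have "{u \<in> U. \<not> v \<rightarrow> u} \<subseteq> I" by blast
  moreover have "{u \<in> U. v \<rightarrow> u} \<subseteq> U - I" using I unfolding indep_def by auto
  ultimately have "dominator U v"
    using v(1) indep_subset[OF I(3)] indep_subset[OF I(4)] unfolding dominator_def by simp
  then show ?thesis by (rule that)
qed

text \<open>In a graph \<open>K\<^sub>n\<^sub>,\<^sub>n\<close> minus a perfect matching, Bob answers every move of Alice with the
  matched vertex, which ends the round.\<close>

lemma rounds_left_mirror:
  assumes "finite U" "st Bob = Alice"
    and "\<And>v. v \<in> U \<Longrightarrow> m v \<in> U \<and> m v \<noteq> v \<and> \<not> v \<rightarrow> m v \<and> m (m v) = v"
    and "\<And>v w. v \<in> U \<Longrightarrow> w \<in> U \<Longrightarrow> w \<noteq> v \<Longrightarrow> w \<noteq> m v \<Longrightarrow> v \<rightarrow> w \<or> m v \<rightarrow> w"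
  shows "card U \<le> 2 * rounds_left st G U {} Alice"
  using assms(1,3,4)
proof (induction "card U" arbitrary: U rule: less_induct)
  case less
  show ?case
  proof (cases "U = {}")
    case False
    let ?f = "\<lambda>v. rounds_left st G (U - {v}) (insert v {}) Bob"
    have "rounds_left st G U {} Alice = Min (?f ` legal_moves G U {})"
      using False less.prems by (subst rounds_left.simps) auto
    also have "\<dots> \<in> ?f ` legal_moves G U {}"
      using False less.prems by (intro Min_in) auto
    finally obtain v where v: "v \<in> U" "rounds_left st G U {} Alice = ?f v" by auto
    let ?w = "m v" and ?W = "U - {v} - {m v}"
    have w: "?w \<in> U" "?w \<noteq> v" "\<not> v \<rightarrow> ?w" using less.prems(2) v by auto
    have "?w \<in> legal_moves G (U - {v}) {v}" using w unfolding legal_moves_def by simp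
    then have "rounds_left st G ?W {?w, v} Alice \<le> rounds_left st G U {} Alice"
      using rounds_left_Bob_ge[of "U - {v}" ?w "{v}" st] v(2) less.prems(1) by simp
    moreover have "legal_moves G ?W {?w, v} = {}"
      using less.prems(3)[OF v(1)] unfolding legal_moves_def by auto
    \<comment> \<open>Bob made the last move, so \<open>st Bob = Alice\<close> hands the opening of
      the next round to Alice, and the induction hypothesis applies to the remaining matched
      pairs.\<close>
    then have "rounds_left st G ?W {?w, v} Alice = Suc (rounds_left st G ?W {} Alice)"
      using less.prems(1) assms(2) by (subst rounds_left_end) auto
    moreover have "card U = Suc (Suc (card ?W))"
      using v w less.prems(1) card_Suc_Diff1[of U v] card_Suc_Diff1[of "U - {v}" ?w] by simp
    moreover have "card ?W \<le> 2 * rounds_left st G ?W {} Alice"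
    proof (rule less.hyps)
      fix u assume u: "u \<in> ?W"
      then have "m u \<in> U" "m u \<noteq> u" "\<not> u \<rightarrow> m u" "m (m u) = u" using less.prems(2) by auto
      moreover have "m u \<noteq> v" "m u \<noteq> m v" using calculation u less.prems(2)[OF v(1)] by auto
      ultimately show "m u \<in> ?W \<and> m u \<noteq> u \<and> \<not> u \<rightarrow> m u \<and> m (m u) = u" by simp
    qed (use less.prems calculation in auto)
    ultimately show ?thesis by linarith
  qed simp
qed

end

text \<open>The recursion only inspects adjacency inside \<open>U \<union> C\<close>. With
  \<open>f\<close> the identity this relates G to its vertex-deleted subgraphs; with
  \<open>f\<close> an enumeration it carries the results on concrete graphs over to G.\<close>

lemma rounds_left_embed:
  fixes G :: "('a, 'b) pre_digraph" and H :: "('c, 'd) pre_digraph"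
  assumes "inj_on f (U \<union> C)"
    and "\<And>u v. u \<in> U \<union> C \<Longrightarrow> v \<in> U \<union> C \<Longrightarrow> f u \<rightarrow>\<^bsub>H\<^esub> f v \<longleftrightarrow> u \<rightarrow>\<^bsub>G\<^esub> v"
  shows "rounds_left st H (f ` U) (f ` C) p = rounds_left st G U C p"
  using assms
proof (induction st G U C p rule: rounds_left.induct)
  case (1 st G U C p)
  note IH = "1.IH"(1) and prems = "1.prems"
  have fin: "finite (f ` U) \<longleftrightarrow> finite U"
    using prems(1) by (simp add: finite_image_iff inj_on_Un)
  have legal: "legal_moves H (f ` U) (f ` C) = f ` legal_moves G U C"
    using prems(2) unfolding legal_moves_def by auto
  have step: "rounds_left st H (f ` U - {f v}) (insert (f v) (f ` C)) q
      = rounds_left st G (U - {v}) (insert v C) q"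
    if "v \<in> legal_moves G U C" "finite U" "q = opponent p" for v q
  proof -
    have v: "v \<in> U" using that unfolding legal_moves_def by simp
    then have eq: "U - {v} \<union> insert v C = U \<union> C" by blast
    have "f ` (U - {v}) = f ` U - {f v}"
      using prems(1) v by (subst inj_on_image_set_diff[of f "U \<union> C"]) auto
    moreover have "rounds_left st H (f ` (U - {v})) (f ` insert v C) q
      = rounds_left st G (U - {v}) (insert v C) q"
      using that prems eq "1.IH"(2)[of v] "1.IH"(3)[of v] by (cases p) auto
    ultimately show ?thesis by simp
  qed
  consider "infinite U" | "finite U" "legal_moves G U C = {}" "C = {}"
    | "finite U" "legal_moves G U C = {}" "C \<noteq> {}" | "finite U" "legal_moves G U C \<noteq> {}"
    by blast
  then show ?case
  proof cases
    case 1
    then show ?thesis using fin by (simp add: rounds_left.simps)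
  next
    case 2
    then show ?thesis using fin legal by (simp add: rounds_left.simps)
  next
    case 3
    have "rounds_left st H (f ` U) (f ` {}) (st (opponent p))
      = rounds_left st G U {} (st (opponent p))"
      using 3 prems by (intro IH) (auto simp: inj_on_Un)
    then show ?thesis
      using 3 fin legal rounds_left.simps[of st H "f ` U" "f ` C" p] rounds_left.simps[of st G U C p]
      by simp
  next
    case 4
    then show ?thesis
      using fin legal step rounds_left.simps[of st H "f ` U" "f ` C" p] rounds_left.simps[of st G U C p]
      by (cases p) (simp_all add: image_image)
  qed
qed

section \<open>Non-bipartite critical graphs\<close>

text \<open>Isomorphism to a concrete graph in list form: \<open>xs\<close> names the vertices and
  \<open>es\<close> gives each edge once, as a pair of positions in \<open>xs\<close>. Comparing
  \<open>arcs_ends\<close> leaves the type of arcs arbitrary.\<close>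

definition realizes :: "('a, 'b) pre_digraph \<Rightarrow> 'a list \<Rightarrow> (nat \<times> nat) list \<Rightarrow> bool" where
  "realizes G xs es \<longleftrightarrow> distinct xs \<and> verts G = set xs \<and>
     (let S = set (map (\<lambda>(i, j). (xs ! i, xs ! j)) es) in arcs_ends G = S \<union> S\<inverse>)"

text \<open>\<open>sun4\<close> is \<open>C\<^sub>4\<^sup>+\<close>. In the bipartite graphs every edge is listed from the same side of the
  bipartition to the other.\<close>

definition cycle3_edges :: "(nat \<times> nat) list" where
  "cycle3_edges = [(0,1), (1,2), (2,0)]"

definition cycle5_edges :: "(nat \<times> nat) list" where
  "cycle5_edges = [(0,1), (1,2), (2,3), (3,4), (4,0)]"

definition path6_edges :: "(nat \<times> nat) list" where
  "path6_edges = [(1,0), (1,2), (3,2), (3,4), (5,4)]"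

definition cycle6_edges :: "(nat \<times> nat) list" where
  "cycle6_edges = [(1,0), (1,2), (3,2), (3,4), (5,4), (5,0)]"

definition sun4_edges :: "(nat \<times> nat) list" where
  "sun4_edges = [(0,1), (2,1), (2,3), (0,3), (0,4), (5,1), (2,6), (7,3)]"

lemmas edge_lists =
  cycle3_edges_def cycle5_edges_def path6_edges_def cycle6_edges_def sun4_edges_def

context graph
begin

lemma indep_insert: "indep S \<Longrightarrow> \<forall>u \<in> S. \<not> x \<rightarrow> u \<Longrightarrow> indep (insert x S)"
  unfolding indep_def by (blast dest: adj_sym adj_not_same)

lemma not_bipartite_triangle:
  assumes "bipartite U" "a \<rightarrow> b" "b \<rightarrow> c" "c \<rightarrow> a" "a \<in> U" "b \<in> U" "c \<in> U"
  shows False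
  using assms adj_sym unfolding bipartite_def indep_def by blast

lemma not_bipartite_pentagon:
  assumes "bipartite U" "a \<rightarrow> b" "b \<rightarrow> c" "c \<rightarrow> d" "d \<rightarrow> e" "e \<rightarrow> a" "{a, b, c, d, e} \<subseteq> U"
  shows False
proof -
  obtain I where I: "I \<subseteq> U" "indep I" "indep (U - I)" using assms(1) unfolding bipartite_def by blast
  have "u \<in> I \<longleftrightarrow> v \<notin> I" if "u \<rightarrow> v" "u \<in> U" "v \<in> U" for u v
    using I that unfolding indep_def by blast
  then show False using assms by (metis insert_subset)
qed

text \<open>Deleting a vertex outside the triangle would leave an odd cycle in a bipartite graph, so
  there is no such vertex.\<close>

lemma realizes_triangle:
  assumes "\<And>x. x \<in> verts G \<Longrightarrow> bipartite (verts G - {x})" "a \<rightarrow> b" "b \<rightarrow> c" "c \<rightarrow> a"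
  shows "realizes G [a, b, c] cycle3_edges"
proof -
  have "a \<in> verts G" "b \<in> verts G" "c \<in> verts G" using assms adj_in_verts by blast+
  moreover have "verts G \<subseteq> {a, b, c}"
  proof
    fix x assume "x \<in> verts G"
    then show "x \<in> {a, b, c}"
      using assms(1)[of x] not_bipartite_triangle[of "verts G - {x}" a b c] assms(2-4) calculation
      by auto
  qed
  ultimately have V: "verts G = {a, b, c}" by blast
  have dist: "distinct [a, b, c]" using assms by auto
  have "u \<rightarrow> v \<longleftrightarrow> u \<in> {a, b, c} \<and> v \<in> {a, b, c} \<and> u \<noteq> v" for u v
    using V adj_in_verts[of u v] assms(2-4) adj_sym by auto
  then have "arcs_ends G = {(u, v). u \<in> {a, b, c} \<and> v \<in> {a, b, c} \<and> u \<noteq> v}" by auto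
  then show ?thesis using V dist unfolding realizes_def cycle3_edges_def by auto
qed

text \<open>As for the triangle, an outside vertex could be deleted without destroying the odd
  cycle. The absence of triangles excludes chords, and also coincidences among the five
  vertices.\<close>

lemma realizes_pentagon:
  assumes "\<And>x. x \<in> verts G \<Longrightarrow> bipartite (verts G - {x})"
    and "\<And>u v w. u \<rightarrow> v \<Longrightarrow> v \<rightarrow> w \<Longrightarrow> w \<rightarrow> u \<Longrightarrow> False"
    and e: "a \<rightarrow> b" "b \<rightarrow> c" "c \<rightarrow> d" "d \<rightarrow> e" "e \<rightarrow> a"
  shows "realizes G [a, b, c, d, e] cycle5_edges"
proof -
  have mem: "{a, b, c, d, e} \<subseteq> verts G" using e adj_in_verts by auto
  have "verts G \<subseteq> {a, b, c, d, e}"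
  proof
    fix x assume "x \<in> verts G"
    then show "x \<in> {a, b, c, d, e}"
      using assms(1)[of x] not_bipartite_pentagon[of "verts G - {x}" a b c d e] e mem by auto
  qed
  then have V: "verts G = {a, b, c, d, e}" using mem by blast
  note e' = e e[THEN adj_sym]
  have chord: "\<not> u \<rightarrow> w" if "u \<rightarrow> v" "v \<rightarrow> w" for u v w
    using that assms(2)[of u v w] adj_sym by blast
  have nonadj: "\<not> a \<rightarrow> c" "\<not> b \<rightarrow> d" "\<not> c \<rightarrow> e" "\<not> d \<rightarrow> a" "\<not> e \<rightarrow> b"
    "\<not> c \<rightarrow> a" "\<not> d \<rightarrow> b" "\<not> e \<rightarrow> c" "\<not> a \<rightarrow> d" "\<not> b \<rightarrow> e"
    using chord e' by blast+
  have dist: "distinct [a, b, c, d, e]" using e nonadj by auto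
  have "(u, v) \<in> arcs_ends G \<longleftrightarrow> (u, v) \<in> {(a, b), (b, c), (c, d), (d, e), (e, a)} \<union>
    {(a, b), (b, c), (c, d), (d, e), (e, a)}\<inverse>" for u v
  proof
    assume "u \<rightarrow> v"
    moreover from this have "u \<in> {a, b, c, d, e}" "v \<in> {a, b, c, d, e}"
      using V adj_in_verts by blast+
    ultimately show "(u, v) \<in> {(a, b), (b, c), (c, d), (d, e), (e, a)} \<union>
      {(a, b), (b, c), (c, d), (d, e), (e, a)}\<inverse>"
      by (elim insertE emptyE) (simp_all add: nonadj)
  qed (use e' in auto)
  then have "arcs_ends G = {(a, b), (b, c), (c, d), (d, e), (e, a)} \<union>
    {(a, b), (b, c), (c, d), (d, e), (e, a)}\<inverse>" by (intro set_eqI) (simp only: split_paired_all)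
  then show ?thesis using V dist unfolding realizes_def cycle5_edges_def by (auto simp: Let_def)
qed

text \<open>The dominator v splits G - x into the sides \<open>?A\<close>, containing v, and
  \<open>?B\<close>. If x had no neighbor in one of them, it could join that side and G would be
  bipartite. So x has neighbors a in \<open>?A\<close> and b in \<open>?B\<close>, and the cycle
  closes through v.\<close>

lemma nonbipartite_critical:
  assumes bip: "\<And>x. x \<in> verts G \<Longrightarrow> bipartite (verts G - {x})"
    and "\<not> bipartite (verts G)" "x \<in> verts G" "conn (verts G - {x})" "dominator (verts G - {x}) v"
  shows "(\<exists>xs. length xs = 3 \<and> realizes G xs cycle3_edges) \<or>
    (\<exists>xs. length xs = 5 \<and> realizes G xs cycle5_edges)"
proof (cases "\<exists>a b c. a \<rightarrow> b \<and> b \<rightarrow> c \<and> c \<rightarrow> a")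
  case True
  then obtain a b c where "realizes G [a, b, c] cycle3_edges" using realizes_triangle[OF bip] by blast
  moreover have "length [a, b, c] = 3" by simp
  ultimately show ?thesis by blast
next
  case no_triangle: False
  let ?W = "verts G - {x}"
  let ?A = "{u \<in> ?W. \<not> v \<rightarrow> u}" and ?B = "{u \<in> ?W. v \<rightarrow> u}"
  have v: "v \<in> ?W" "indep ?A" "indep ?B" using assms(5) unfolding dominator_def by auto
  have "\<exists>a \<in> ?A. x \<rightarrow> a"
  proof (rule ccontr)
    assume "\<not> ?thesis"
    then have "indep (insert x ?A)" using v(2) by (intro indep_insert) auto
    moreover have "verts G - insert x ?A = ?B" "insert x ?A \<subseteq> verts G" using assms(3) by auto
    moreover note \<open>indep ?B\<close>
    ultimately have "bipartite (verts G)"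
      unfolding bipartite_def by (intro exI[of _ "insert x ?A"]) simp
    then show False using assms(2) by simp
  qed
  then obtain a where a: "a \<in> ?A" "x \<rightarrow> a" by blast
  have "\<exists>b \<in> ?B. x \<rightarrow> b"
  proof (rule ccontr)
    assume "\<not> ?thesis"
    then have "indep (insert x ?B)" using v(3) by (intro indep_insert) auto
    moreover have "verts G - insert x ?B = ?A" "insert x ?B \<subseteq> verts G" using assms(3) by auto
    moreover note \<open>indep ?A\<close>
    ultimately have "bipartite (verts G)"
      unfolding bipartite_def by (intro exI[of _ "insert x ?B"]) simp
    then show False using assms(2) by simp
  qed
  then obtain b where b: "b \<in> ?B" "x \<rightarrow> b" by blast
  have "\<not> x \<rightarrow> v" using no_triangle b adj_sym by blast
  then have "a \<noteq> v" using a by blast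
  \<comment> \<open>In the connected G - x the vertex a is not isolated, because v is another
    vertex. A neighbor of a lies in \<open>?B\<close> and is therefore adjacent to v.\<close>
  have "\<exists>b' \<in> ?W. a \<rightarrow> b'"
  proof (rule ccontr)
    assume "\<not> ?thesis"
    then have "{a} = ?W" using a(1) by (intro connD[OF assms(4)]) auto
    then show False using v(1) \<open>a \<noteq> v\<close> by (metis singletonD)
  qed
  then obtain b' where b': "b' \<in> ?W" "a \<rightarrow> b'" by blast
  then have "v \<rightarrow> b'" using v(2) a(1) unfolding indep_def by blast
  have "realizes G [x, a, b', v, b] cycle5_edges"
  proof (rule realizes_pentagon[OF bip])
    show "False" if "u \<rightarrow> v" "v \<rightarrow> w" "w \<rightarrow> u" for u v w using that no_triangle by blast
  qed (use a(2) b b'(2) \<open>v \<rightarrow> b'\<close>[THEN adj_sym] b(2)[THEN adj_sym] in simp_all)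
  moreover have "length [x, a, b', v, b] = 5" by simp
  ultimately show ?thesis by blast
qed

section \<open>Cut vertices\<close>

text \<open>\<open>S\<close> is a union of components of G - c, neither empty nor everything.
  Allowing unions makes the complement again such a set.\<close>

definition separates :: "'a \<Rightarrow> 'a set \<Rightarrow> bool" where
  "separates c S \<longleftrightarrow> c \<in> verts G \<and> S \<subseteq> verts G - {c} \<and> S \<noteq> {} \<and> verts G - {c} - S \<noteq> {} \<and>
     (\<forall>u \<in> S. \<forall>v. u \<rightarrow> v \<longrightarrow> v \<in> insert c S)"

lemma separates_if_not_conn:
  assumes "c \<in> verts G" "\<not> conn (verts G - {c})" shows "\<exists>S. separates c S"
proof -
  from assms(2) obtain S where "S \<subseteq> verts G - {c}" "S \<noteq> {}" "S \<noteq> verts G - {c}"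
    "\<forall>u \<in> S. \<forall>v \<in> verts G - {c}. u \<rightarrow> v \<longrightarrow> v \<in> S"
    unfolding conn_def by auto
  then have "separates c S" using assms(1) adj_in_verts unfolding separates_def by auto
  then show ?thesis ..
qed

lemma separates_complement:
  assumes "separates c S" shows "separates c (verts G - {c} - S)"
proof -
  have "v \<in> insert c (verts G - {c} - S)" if u: "u \<in> verts G - {c} - S" "u \<rightarrow> v" for u v
  proof -
    have "v \<notin> S"
    proof
      assume "v \<in> S"
      moreover have "v \<rightarrow> u" using u adj_sym by blast
      ultimately show False using assms u(1) unfolding separates_def by blast
    qed
    then show ?thesis using u(2) adj_in_verts by auto
  qed
  moreover have "verts G - {c} - (verts G - {c} - S) = S" using assms unfolding separates_def by blast
  ultimately show ?thesis using assms unfolding separates_def by simp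
qed

text \<open>If s were a cut vertex, take a set \<open>S'\<close> separated by s that avoids c. If it
  misses \<open>S\<close>, no vertex of it is adjacent to s, whose neighbors lie in
  \<open>insert c S\<close>, and \<open>S'\<close> would be closed in a connected graph. Otherwise s
  separates \<open>S' \<inter> S\<close>, which is smaller than \<open>S\<close> because it lacks
  s.\<close>

lemma conn_remove_in_minimal_separated:
  assumes "conn (verts G)" "separates c S" "\<forall>c' S'. separates c' S' \<longrightarrow> card S \<le> card S'" "s \<in> S"
  shows "conn (verts G - {s})"
proof (rule ccontr)
  assume "\<not> ?thesis"
  moreover have s: "s \<in> verts G" "s \<noteq> c" using assms unfolding separates_def by auto
  ultimately obtain S1 where "separates s S1" using separates_if_not_conn by blast
  then obtain S' where S': "separates s S'" "c \<notin> S'"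
    using separates_complement[of s S1] s by (cases "c \<in> S1") auto
  show False
  proof (cases "S' \<inter> S = {}")
    case True
    have "\<forall>u \<in> S'. \<forall>v \<in> verts G. u \<rightarrow> v \<longrightarrow> v \<in> S'"
    proof (intro ballI impI)
      fix u v assume u: "u \<in> S'" "u \<rightarrow> v"
      have "v \<noteq> s"
      proof
        assume "v = s"
        then have "s \<rightarrow> u" using u adj_sym by blast
        then have "u \<in> insert c S" using assms(2,4) unfolding separates_def by blast
        then show False using True u(1) S'(2) by blast
      qed
      then show "v \<in> S'" using S'(1) u unfolding separates_def by blast
    qed
    moreover have "S' \<subseteq> verts G" "S' \<noteq> {}" "S' \<noteq> verts G"
      using S'(1) s unfolding separates_def by auto
    ultimately show False using assms(1) unfolding conn_def by blast
  next
    case False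
    have "v \<in> insert s (S' \<inter> S)" if "u \<in> S' \<inter> S" "u \<rightarrow> v" for u v
      using that S' assms(2) s(2) unfolding separates_def by blast
    moreover have "c \<in> verts G - {s} - S' \<inter> S" "S' \<inter> S \<subseteq> verts G - {s}"
      using S' s assms(2) unfolding separates_def by auto
    ultimately have "separates s (S' \<inter> S)" using False s(1) unfolding separates_def by blast
    then have "card S \<le> card (S' \<inter> S)" using assms(3) by blast
    moreover have "S' \<inter> S \<subset> S" using assms(4) S' unfolding separates_def by auto
    moreover have "finite S" using assms(2) unfolding separates_def by (auto intro: finite_subset)
    ultimately show False using psubset_card_mono[of S "S' \<inter> S"] by simp
  qed
qed

lemma minimal_separated:
  assumes "c \<in> verts G" "\<not> conn (verts G - {c})"
  shows "\<exists>c S. separates c S \<and> (\<forall>c' S'. separates c' S' \<longrightarrow> card S \<le> card S')"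
proof -
  obtain S where "separates c S" using assms separates_if_not_conn by blast
  then show ?thesis
    using ex_has_least_nat[of "\<lambda>(c, S). separates c S" "(c, S)" "\<lambda>(c, S). card S"] by auto
qed

lemma conn_remove_exists:
  assumes "verts G \<noteq> {}" "conn (verts G)" shows "\<exists>x \<in> verts G. conn (verts G - {x})"
proof (rule ccontr)
  assume cut: "\<not> ?thesis"
  then obtain c S where S: "separates c S" "\<forall>c' S'. separates c' S' \<longrightarrow> card S \<le> card S'"
    using minimal_separated assms(1) by blast
  then obtain s where "s \<in> S" "s \<in> verts G" unfolding separates_def by blast
  then show False using conn_remove_in_minimal_separated[OF assms(2) S] cut by blast
qed

definition leaf :: "'a \<Rightarrow> 'a \<Rightarrow> bool" where
  "leaf l c \<longleftrightarrow> (\<forall>v. l \<rightarrow> v \<longleftrightarrow> v = c)"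

lemma conn_remove_leaf:
  assumes "conn (verts G)" "leaf l c" shows "conn (verts G - {l})"
  unfolding conn_def
proof (intro allI impI)
  fix X assume X: "X \<subseteq> verts G - {l}" "X \<noteq> {}" "\<forall>u \<in> X. \<forall>v \<in> verts G - {l}. u \<rightarrow> v \<longrightarrow> v \<in> X"
  have l: "l \<rightarrow> c" "l \<in> verts G" using assms(2) adj_in_verts unfolding leaf_def by blast+
  show "X = verts G - {l}"
  proof (cases "c \<in> X")
    case True
    then have "\<forall>u \<in> insert l X. \<forall>v \<in> verts G. u \<rightarrow> v \<longrightarrow> v \<in> insert l X"
      using X assms(2) unfolding leaf_def by auto
    moreover have "insert l X \<subseteq> verts G" "insert l X \<noteq> {}" using X(1) l by auto
    ultimately have "insert l X = verts G" using assms(1) unfolding conn_def by blast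
    then show ?thesis using X by blast
  next
    case False
    have "\<not> u \<rightarrow> l" if "u \<in> X" for u
      using False that adj_sym[of u l] assms(2) unfolding leaf_def by auto
    then have "\<forall>u \<in> X. \<forall>v \<in> verts G. u \<rightarrow> v \<longrightarrow> v \<in> X" using X(3) by blast
    then have "X = verts G" using assms(1) X unfolding conn_def by blast
    then show ?thesis using X l by blast
  qed
qed

end

section \<open>Bipartite critical graphs\<close>

locale bipartition = graph G for G :: "('a, 'b) pre_digraph" (structure) +
  fixes P Q :: "'a set"
  assumes sides: "verts G = P \<union> Q" "P \<inter> Q = {}" "indep P" "indep Q"
begin

lemma swap_bipartition: "bipartition G Q P"
  by unfold_locales (use sides in auto)

lemma adj_P: "u \<rightarrow> v \<Longrightarrow> u \<in> P \<longleftrightarrow> v \<in> Q"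
  and adj_Q: "u \<rightarrow> v \<Longrightarrow> u \<in> Q \<longleftrightarrow> v \<in> P"
  using sides adj_in_verts[of u v] unfolding indep_def by blast+

text \<open>Every edge has exactly one end in \<open>Q\<close>, so the arcs leaving \<open>Q\<close>
  determine all others by symmetry. This is why the edge lists are oriented from one side to the
  other.\<close>

lemma realizesI:
  assumes "distinct xs" "set xs = P \<union> Q" "S = set (map (\<lambda>(i, j). (xs ! i, xs ! j)) es)"
    and "\<And>q p. q \<in> Q \<Longrightarrow> q \<rightarrow> p \<longleftrightarrow> (q, p) \<in> S" "S \<subseteq> Q \<times> P"
  shows "realizes G xs es"
proof -
  have "arcs_ends G \<subseteq> S \<union> S\<inverse>"
  proof (rule subrelI)
    fix u v assume uv: "u \<rightarrow> v"
    then have "u \<in> Q \<or> v \<in> Q" using adj_P adj_in_verts sides by blast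
    then show "(u, v) \<in> S \<union> S\<inverse>" using uv adj_sym[OF uv] assms(4) by auto
  qed
  moreover have "S \<subseteq> arcs_ends G" using assms(4,5) by auto
  moreover have "S\<inverse> \<subseteq> arcs_ends G" using assms(4,5) adj_sym by blast
  ultimately have "arcs_ends G = S \<union> S\<inverse>" by blast
  then show ?thesis using assms(1-3) sides(1) unfolding realizes_def by simp
qed

lemma mirror_realizes_cycle6:
  assumes "card P = 3" "bij_betw m P Q" "\<And>p q. p \<in> P \<Longrightarrow> q \<in> Q \<Longrightarrow> p \<rightarrow> q \<longleftrightarrow> q \<noteq> m p"
  shows "\<exists>xs. length xs = 6 \<and> realizes G xs cycle6_edges"
proof -
  obtain a b c where P: "P = {a, b, c}" and dist: "a \<noteq> b" "a \<noteq> c" "b \<noteq> c"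
    using assms(1) unfolding card_3_iff by blast
  have Q: "Q = {m a, m b, m c}" using assms(2) P unfolding bij_betw_def by auto
  have mdist: "m a \<noteq> m b" "m a \<noteq> m c" "m b \<noteq> m c"
    using assms(2) P dist unfolding bij_betw_def inj_on_def by auto
  have disj: "\<forall>p \<in> {a, b, c}. \<forall>q \<in> {m a, m b, m c}. p \<noteq> q \<and> q \<noteq> p"
    using sides(2) P Q by blast
  \<comment> \<open>A hexagon whose antipodal positions carry the matched pairs: K_{3,3} minus a
    perfect matching is C_6.\<close>
  let ?xs = "[a, m b, c, m a, b, m c]"
  have "distinct ?xs" using disj by (simp add: dist mdist dist[symmetric] mdist[symmetric])
  have N: "q \<rightarrow> p \<longleftrightarrow> p \<in> P \<and> q \<noteq> m p" if "q \<in> Q" for p q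
  proof -
    have "q \<rightarrow> p \<longleftrightarrow> p \<rightarrow> q" using adj_sym by blast
    moreover have "p \<in> P" if "q \<rightarrow> p" using adj_Q[OF that] \<open>q \<in> Q\<close> by simp
    ultimately show ?thesis using assms(3)[of p q] that by blast
  qed
  have "realizes G ?xs cycle6_edges"
  proof (rule realizesI[OF \<open>distinct ?xs\<close> _ refl])
    show "set ?xs = P \<union> Q" using P Q by auto
    fix q u assume q: "q \<in> Q"
    have "m u = m v \<longleftrightarrow> u = v" if "u \<in> P" "v \<in> P" for u v
      using that assms(2) unfolding bij_betw_def inj_on_def by blast
    then have eq: "q \<rightarrow> u \<longleftrightarrow> (u = a \<and> q \<noteq> m a \<or> u = b \<and> q \<noteq> m b \<or> u = c \<and> q \<noteq> m c)"
      using N[OF q, of u] P by auto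
    have "q = m a \<or> q = m b \<or> q = m c" using q Q by blast
    then show "q \<rightarrow> u \<longleftrightarrow> (q, u) \<in> set (map (\<lambda>(i, j). (?xs ! i, ?xs ! j)) cycle6_edges)"
      unfolding eq by (elim disjE) (simp_all add: cycle6_edges_def mdist mdist[symmetric] disj_commute)
  qed (auto simp: P Q cycle6_edges_def)
  moreover have "length ?xs = 6" by simp
  ultimately show ?thesis by blast
qed

end

text \<open>The assumptions are what the criticality of a bipartite graph with sides \<open>P\<close>, \<open>Q\<close> amounts to:
  no vertex is adjacent to the whole opposite side, but after the removal of any vertex \<open>x\<close>
  that is not a cut vertex there is such a vertex.\<close>

locale bipartite_critical = bipartition +
  assumes conn: "conn (verts G)"
    and not_dominating_P: "p \<in> P \<Longrightarrow> \<exists>q \<in> Q. \<not> p \<rightarrow> q"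
    and not_dominating_Q: "q \<in> Q \<Longrightarrow> \<exists>p \<in> P. \<not> q \<rightarrow> p"
    and nearly_dominating_P: "x \<in> P \<Longrightarrow> conn (verts G - {x}) \<Longrightarrow> \<exists>y \<in> Q. \<forall>p. y \<rightarrow> p \<longleftrightarrow> p \<in> P - {x}"
    and nearly_dominating_Q: "x \<in> Q \<Longrightarrow> conn (verts G - {x}) \<Longrightarrow> \<exists>y \<in> P. \<forall>q. y \<rightarrow> q \<longleftrightarrow> q \<in> Q - {x}"
begin

text \<open>The assumptions are symmetric in the two sides, so a second interpretation of the locale
  turns each result about \<open>P\<close> into one about \<open>Q\<close>.\<close>

lemma swap_sides: "bipartite_critical G Q P"
proof (intro bipartite_critical.intro bipartite_critical_axioms.intro)
  show "bipartition G Q P" by (rule swap_bipartition)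
qed (use conn not_dominating_P not_dominating_Q nearly_dominating_P nearly_dominating_Q in auto)

section \<open>Leaves of bipartite critical graphs\<close>

lemma has_neighbor:
  assumes "u \<in> verts G" shows "\<exists>v. u \<rightarrow> v"
proof (rule ccontr)
  assume "\<not> ?thesis"
  then have "{u} = verts G" using assms by (intro connD[OF conn]) auto
  then have "P \<union> Q = {u}" using sides(1) by simp
  then have "\<not> (\<exists>q \<in> Q. u \<in> P)" "\<not> (\<exists>p \<in> P. u \<in> Q)" "u \<in> P \<or> u \<in> Q" using sides(2) by auto
  then show False using not_dominating_P[of u] not_dominating_Q[of u] by blast
qed

lemma leaf_adj: "leaf l c \<Longrightarrow> l \<rightarrow> c" "leaf l c \<Longrightarrow> c \<rightarrow> l" "leaf l c \<Longrightarrow> u \<rightarrow> l \<Longrightarrow> u = c"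
  "leaf l c \<Longrightarrow> l \<rightarrow> u \<Longrightarrow> u = c"
  unfolding leaf_def using adj_sym by blast+

text \<open>The cut vertex c has neighbors s in \<open>S\<close> and t beyond it. As s is not a cut
  vertex, some y is adjacent to all of \<open>P\<close> but s. Being adjacent to t and different
  from c, it lies outside \<open>S\<close>, so s is the only vertex of \<open>P\<close> in
  \<open>S\<close>. Hence either \<open>S\<close> is the single leaf s, or a further vertex of
  \<open>S\<close> is a leaf at s.\<close>

lemma leaf_in_minimal_separated:
  assumes "separates c S" "\<forall>c' S'. separates c' S' \<longrightarrow> card S \<le> card S'" "c \<in> Q"
  shows "\<exists>l c. leaf l c"
proof -
  let ?T = "verts G - {c} - S"
  have S: "S \<subseteq> verts G" "c \<notin> S" "S \<noteq> {}" "?T \<noteq> {}" "\<And>u v. u \<in> S \<Longrightarrow> u \<rightarrow> v \<Longrightarrow> v \<in> insert c S"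
    using assms(1) unfolding separates_def by auto
  have T: "v \<in> insert c ?T" if "u \<in> ?T" "u \<rightarrow> v" for u v
    using separates_complement[OF assms(1)] that unfolding separates_def by blast
  have "\<exists>s \<in> S. s \<rightarrow> c"
  proof (rule ccontr)
    assume "\<not> ?thesis"
    then have "S = verts G" using S by (intro connD[OF conn]) blast+
    then show False using S(4) by blast
  qed
  then obtain s where s: "s \<in> S" "s \<rightarrow> c" by blast
  have "\<exists>t \<in> ?T. t \<rightarrow> c"
  proof (rule ccontr)
    assume "\<not> ?thesis"
    then have "?T = verts G" using S(4) T by (intro connD[OF conn]) blast+
    then show False using S(1,3) by blast
  qed
  then obtain t where t: "t \<in> ?T" "t \<rightarrow> c" by blast
  have "s \<in> P" "t \<in> P" using s t adj_P assms(3) by auto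
  have noncut: "conn (verts G - {x})" if "x \<in> S" for x
    using conn_remove_in_minimal_separated[OF conn assms(1,2) that] .
  then obtain y where y: "y \<in> Q" "\<forall>p. y \<rightarrow> p \<longleftrightarrow> p \<in> P - {s}"
    using nearly_dominating_P[OF \<open>s \<in> P\<close>] s(1) by blast
  have "y \<noteq> c" using y(2) s(2) adj_sym by blast
  moreover have "y \<rightarrow> t" using y(2) \<open>t \<in> P\<close> s(1) t(1) by blast
  then have "y \<in> insert c ?T" using T[OF t(1)] adj_sym by blast
  ultimately have "y \<in> ?T" by blast
  have SP: "p = s" if "p \<in> S" "p \<in> P" for p
  proof (rule ccontr)
    assume "p \<noteq> s"
    then have "y \<rightarrow> p" using y(2) that by blast
    then have "p \<in> insert c ?T" using T[OF \<open>y \<in> ?T\<close>] by blast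
    then show False using that(1) S(2) by blast
  qed
  show ?thesis
  proof (cases "S = {s}")
    case True
    then have "s \<rightarrow> v \<longleftrightarrow> v = c" for v using s(2) S(5)[of s v] by auto
    then show ?thesis unfolding leaf_def by blast
  next
    case False
    then obtain u where u: "u \<in> S" "u \<noteq> s" using s(1) by blast
    then have "u \<in> Q" using SP S(1) sides(1) by blast
    have "v = s" if "u \<rightarrow> v" for v
      using S(5)[OF u(1) that] SP adj_Q[OF that] \<open>u \<in> Q\<close> assms(3) sides(2) by blast
    moreover obtain v where "u \<rightarrow> v" using has_neighbor u(1) S(1) by blast
    ultimately have "leaf u s" unfolding leaf_def by blast
    then show ?thesis by blast
  qed
qed

text \<open>In G - x every vertex of \<open>P\<close> other than l is adjacent to d, and l reaches d
  through c and p. A vertex of \<open>Q\<close> with a neighbor other than x reaches d through it.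
  Only leaves at x can be cut off.\<close>

lemma cut_vertex_has_leaf:
  assumes d: "d \<in> Q" "\<forall>p. d \<rightarrow> p \<longleftrightarrow> p \<in> P - {l}" and l: "leaf l c"
    and x: "x \<in> P" "x \<noteq> l" "p \<in> P" "p \<noteq> l" "p \<noteq> x" "c \<rightarrow> p"
    and "\<not> conn (verts G - {x})"
  shows "\<exists>q \<in> Q. leaf q x"
proof (rule ccontr)
  assume no_leaf: "\<not> ?thesis"
  let ?W = "verts G - {x}"
  \<comment> \<open>A nonempty set closed under adjacency in G - x contains d. Its complement is
    closed as well, and d cannot lie in both.\<close>
  have in_Q: "d \<in> X" if X: "X \<subseteq> ?W" "X \<noteq> {}" "\<And>u v. u \<in> X \<Longrightarrow> v \<in> ?W \<Longrightarrow> u \<rightarrow> v \<Longrightarrow> v \<in> X" for X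
  proof -
    have dW: "d \<in> ?W" using d(1) sides x(1) by blast
    have P: "d \<in> X" if "u \<in> X" "u \<in> P" for u
    proof (cases "u = l")
      case False
      then have "d \<rightarrow> u" using d(2) that by blast
      then show ?thesis using X(3)[OF that(1) dW] adj_sym by blast
    next
      case True
      have "c \<in> ?W" using leaf_adj(1)[OF l] x(1) \<open>u \<in> P\<close> True adj_P[of l c] sides adj_in_verts by blast
      then have "c \<in> X" using X(3)[of l c] leaf_adj(1)[OF l] True that by blast
      moreover have "p \<in> ?W" using x sides by blast
      ultimately have "p \<in> X" using X(3) x(6) by blast
      moreover have "p \<rightarrow> d" using d(2) x(3,4) adj_sym by blast
      ultimately show ?thesis using X(3) dW by blast
    qed
    obtain u where u: "u \<in> X" using X(2) by blast
    show ?thesis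
    proof (cases "u \<in> P")
      case False
      then have "u \<in> Q" using u X(1) sides by blast
      have "\<exists>v. u \<rightarrow> v \<and> v \<noteq> x"
      proof (rule ccontr)
        assume "\<not> ?thesis"
        moreover obtain v where "u \<rightarrow> v" using has_neighbor[of u] u X(1) by blast
        ultimately have "leaf u x" unfolding leaf_def by blast
        then show False using no_leaf \<open>u \<in> Q\<close> by blast
      qed
      then obtain v where v: "u \<rightarrow> v" "v \<noteq> x" by blast
      then have "v \<in> P" using adj_Q \<open>u \<in> Q\<close> by blast
      moreover have "v \<in> X" using X(3)[OF u _ v(1)] v(2) \<open>v \<in> P\<close> sides by blast
      ultimately show ?thesis using P by blast
    qed (use P u in blast)
  qed
  have "conn ?W"
    unfolding conn_def
  proof (intro allI impI, rule ccontr)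
    fix X assume X: "X \<subseteq> ?W" "X \<noteq> {}" "\<forall>u \<in> X. \<forall>v \<in> ?W. u \<rightarrow> v \<longrightarrow> v \<in> X" "X \<noteq> ?W"
    then have "d \<in> X" by (intro in_Q) blast+
    moreover have "d \<in> ?W - X"
    proof (rule in_Q)
      fix u v assume "u \<in> ?W - X" "v \<in> ?W" "u \<rightarrow> v"
      then show "v \<in> ?W - X" using X(3) adj_sym by blast
    qed (use X in blast)+
    ultimately show False by blast
  qed
  then show False using assms(10) by simp
qed

text \<open>Two facts alternate: a cut vertex carries a leaf, and a non-cut vertex has a nearly
  dominating partner, which must be adjacent to all leaves of the partner's opposite side except
  possibly the deleted one. Applied on both sides they produce the cycle c, p, d, d' with the leaves
  l, q, s, r in this order. A further vertex would be a cut vertex with a leaf of its own, but only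
  the four known leaves are non-cut vertices.\<close>

lemma leaf_at_big_vertex:
  assumes l: "l \<in> P" "leaf l c" and p: "c \<rightarrow> p" "c \<rightarrow> p2" "p \<noteq> p2" "p \<noteq> l" "p2 \<noteq> l"
  shows "\<exists>xs. length xs = 8 \<and> realizes G xs sun4_edges"
proof -
  interpret swap: bipartite_critical G Q P by (rule swap_sides)
  have c: "c \<in> Q" using leaf_adj(1)[OF l(2)] l(1) adj_P by blast
  have pP: "p \<in> P" "p2 \<in> P" using p c adj_Q by blast+
  have "conn (verts G - {l})" using conn_remove_leaf[OF conn l(2)] .
  then obtain d where d: "d \<in> Q" "\<forall>p. d \<rightarrow> p \<longleftrightarrow> p \<in> P - {l}"
    using nearly_dominating_P l(1) by blast
  have "d \<noteq> c" using d(2) leaf_adj(2)[OF l(2)] by blast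
  \<comment> \<open>The vertex c needs a neighbor besides l and x, and one of p and p2 is different
    from x.\<close>
  have cutP: "\<exists>q \<in> Q. leaf q x" if x: "x \<in> P" "x \<noteq> l" "\<not> conn (verts G - {x})" for x
  proof (cases "x = p")
    case True
    then show ?thesis using cut_vertex_has_leaf[OF d l(2) x(1,2) pP(2) p(5) _ p(2) x(3)] p(3) by blast
  next
    case False
    then show ?thesis using cut_vertex_has_leaf[OF d l(2) x(1,2) pP(1) p(4) _ p(1) x(3)] by blast
  qed
  \<comment> \<open>The partner y of x is adjacent to the leaf l, hence is c itself, and it misses
    x.\<close>
  have noncutP: "\<not> c \<rightarrow> x" if x: "x \<in> P" "x \<noteq> l" "conn (verts G - {x})" for x
  proof -
    obtain y where y: "y \<in> Q" "\<forall>p. y \<rightarrow> p \<longleftrightarrow> p \<in> P - {x}" using nearly_dominating_P x by blast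
    then have "y = c" using l(1) x(2) leaf_adj(3)[OF l(2)] by blast
    then show ?thesis using y(2) by blast
  qed
  obtain q where q: "q \<in> Q" "leaf q p" using cutP noncutP pP(1) p by blast
  have "q \<noteq> c" using leaf_adj(4)[OF q(2)] p(2,3) by blast
  have "q \<noteq> d" using leaf_adj(4)[OF q(2)] d(2) pP(2) p(3,5) by blast
  have "conn (verts G - {q})" using conn_remove_leaf[OF conn q(2)] .
  then obtain d' where d': "d' \<in> P" "\<forall>z. d' \<rightarrow> z \<longleftrightarrow> z \<in> Q - {q}"
    using nearly_dominating_Q q(1) by blast
  have "d' \<rightarrow> c" "d' \<rightarrow> d" using d' c d(1) \<open>q \<noteq> c\<close> \<open>q \<noteq> d\<close> by blast+
  have "d' \<noteq> l" using leaf_adj(4)[OF l(2)] \<open>d' \<rightarrow> d\<close> \<open>d \<noteq> c\<close> by blast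
  have "d' \<noteq> p" using d'(2) leaf_adj(2)[OF q(2)] by blast
  obtain r where r: "r \<in> Q" "leaf r d'"
    using cutP noncutP d'(1) \<open>d' \<noteq> l\<close> adj_sym[OF \<open>d' \<rightarrow> c\<close>] by blast
  have "p \<rightarrow> c" "p \<rightarrow> d" using p(1,4) d(2) pP(1) adj_sym by blast+
  have "r \<noteq> q" using leaf_adj(1)[OF r(2)] leaf_adj(4)[OF q(2)] \<open>d' \<noteq> p\<close> by blast
  have "r \<noteq> c" using leaf_adj(4)[OF r(2)] leaf_adj(2)[OF l(2)] \<open>d' \<noteq> l\<close> by blast
  have "r \<noteq> d" using leaf_adj(4)[OF r(2)] adj_sym[OF \<open>p \<rightarrow> d\<close>] \<open>d' \<noteq> p\<close> by blast
  \<comment> \<open>The same fact with the sides exchanged: d', q and p take the roles of d, l and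
    c, while d or c is the second neighbor of p.\<close>
  have cutQ: "\<exists>s \<in> P. leaf s x" if x: "x \<in> Q" "x \<noteq> q" "\<not> conn (verts G - {x})" for x
  proof (cases "x = c")
    case True
    then show ?thesis
      using swap.cut_vertex_has_leaf[OF d' q(2) x(1,2) d(1) _ _ \<open>p \<rightarrow> d\<close> x(3)] \<open>q \<noteq> d\<close> \<open>d \<noteq> c\<close> by blast
  next
    case False
    then show ?thesis
      using swap.cut_vertex_has_leaf[OF d' q(2) x(1,2) c _ _ \<open>p \<rightarrow> c\<close> x(3)] \<open>q \<noteq> c\<close> by blast
  qed
  \<comment> \<open>Otherwise the partner of x would be adjacent to both leaves q and r, which hang
    at different vertices.\<close>
  have noncutQ: "x = q \<or> x = r" if x: "x \<in> Q" "conn (verts G - {x})" for x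
  proof (rule ccontr)
    assume "\<not> ?thesis"
    moreover obtain y where y: "y \<in> P" "\<forall>z. y \<rightarrow> z \<longleftrightarrow> z \<in> Q - {x}" using nearly_dominating_Q x by blast
    ultimately have "y \<rightarrow> q" "y \<rightarrow> r" using q(1) r(1) by blast+
    then show False using leaf_adj(3)[OF q(2)] leaf_adj(3)[OF r(2)] \<open>d' \<noteq> p\<close> by blast
  qed
  obtain s where s: "s \<in> P" "leaf s d" using cutQ noncutQ d(1) \<open>q \<noteq> d\<close> \<open>r \<noteq> d\<close> by blast
  have "\<not> s \<rightarrow> c" using leaf_adj(4)[OF s(2)] \<open>d \<noteq> c\<close> by blast
  then have "s \<noteq> l" "s \<noteq> p" "s \<noteq> d'"
    using leaf_adj(1)[OF l(2)] \<open>p \<rightarrow> c\<close> \<open>d' \<rightarrow> c\<close> by blast+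
  have noncutP': "x = l \<or> x = s" if x: "x \<in> P" "conn (verts G - {x})" for x
  proof (rule ccontr)
    assume "\<not> ?thesis"
    moreover obtain y where y: "y \<in> Q" "\<forall>p. y \<rightarrow> p \<longleftrightarrow> p \<in> P - {x}" using nearly_dominating_P x by blast
    ultimately have "y \<rightarrow> l" "y \<rightarrow> s" using l(1) s(1) by blast+
    then show False using leaf_adj(3)[OF l(2)] leaf_adj(3)[OF s(2)] \<open>d \<noteq> c\<close> by blast
  qed
  have Q: "Q = {c, d, q, r}"
  proof
    show "Q \<subseteq> {c, d, q, r}"
    proof
      fix x assume x: "x \<in> Q"
      show "x \<in> {c, d, q, r}"
      proof (rule ccontr)
        assume "\<not> ?thesis"
        then have "x \<noteq> c" "x \<noteq> d" "x \<noteq> q" "x \<noteq> r" by auto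
        then obtain t where t: "t \<in> P" "leaf t x" using cutQ noncutQ x by blast
        then have "t = l \<or> t = s" using noncutP' conn_remove_leaf[OF conn] by blast
        then show False
          using leaf_adj(1)[OF t(2)] leaf_adj(4)[OF l(2)] leaf_adj(4)[OF s(2)] \<open>x \<noteq> c\<close> \<open>x \<noteq> d\<close> by blast
      qed
    qed
  qed (use c d q r in auto)
  have P: "P = {p, d', l, s}"
  proof
    show "P \<subseteq> {p, d', l, s}"
    proof
      fix x assume x: "x \<in> P"
      show "x \<in> {p, d', l, s}"
      proof (rule ccontr)
        assume "\<not> ?thesis"
        then have "x \<noteq> p" "x \<noteq> d'" "x \<noteq> l" "x \<noteq> s" by auto
        then obtain t where t: "t \<in> Q" "leaf t x" using cutP noncutP' x by blast
        then have "t = q \<or> t = r" using noncutQ conn_remove_leaf[OF conn] by blast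
        then show False
          using leaf_adj(1)[OF t(2)] leaf_adj(4)[OF q(2)] leaf_adj(4)[OF r(2)] \<open>x \<noteq> p\<close> \<open>x \<noteq> d'\<close> by blast
      qed
    qed
  qed (use pP d' l s in auto)
  have Nc: "c \<rightarrow> u \<longleftrightarrow> u \<in> {p, d', l}" for u
  proof
    assume "c \<rightarrow> u"
    moreover from this have "u \<in> P" using adj_Q c by blast
    moreover have "u \<noteq> s" using \<open>c \<rightarrow> u\<close> \<open>\<not> s \<rightarrow> c\<close> adj_sym by blast
    ultimately show "u \<in> {p, d', l}" using P by blast
  qed (use p(1) adj_sym[OF \<open>d' \<rightarrow> c\<close>] leaf_adj(2)[OF l(2)] in blast)
  have Nd: "d \<rightarrow> u \<longleftrightarrow> u \<in> {p, d', s}" for u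
    using d(2) P \<open>d' \<noteq> l\<close> \<open>s \<noteq> l\<close> p(4) by blast
  have Nqr: "q \<rightarrow> u \<longleftrightarrow> u = p" "r \<rightarrow> u \<longleftrightarrow> u = d'" for u using q(2) r(2) unfolding leaf_def by blast+
  let ?xs = "[c, p, d, d', l, q, s, r]"
  have "P \<inter> Q = {}" using sides by simp
  then have "distinct ?xs"
    using P Q p(4) \<open>d \<noteq> c\<close> \<open>q \<noteq> c\<close> \<open>q \<noteq> d\<close> \<open>d' \<noteq> l\<close> \<open>d' \<noteq> p\<close> \<open>r \<noteq> q\<close> \<open>r \<noteq> c\<close> \<open>r \<noteq> d\<close>
      \<open>s \<noteq> l\<close> \<open>s \<noteq> p\<close> \<open>s \<noteq> d'\<close> by auto
  then have "realizes G ?xs sun4_edges"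
  proof (rule realizesI[OF _ _ refl])
    show "set ?xs = P \<union> Q" using P Q by auto
    fix z u assume "z \<in> Q"
    then consider "z = c" | "z = d" | "z = q" | "z = r" using Q by blast
    then show "z \<rightarrow> u \<longleftrightarrow> (z, u) \<in> set (map (\<lambda>(i, j). (?xs ! i, ?xs ! j)) sun4_edges)"
      using \<open>distinct ?xs\<close> by cases (auto simp: Nc Nd Nqr sun4_edges_def)
  qed (auto simp: P Q sun4_edges_def)
  moreover have "length ?xs = 8" by simp
  ultimately show ?thesis by blast
qed

text \<open>Every neighbor of a leaf has at most one other neighbor, so starting from l the graph
  can only grow as the path l, c, p, d, x, z. The point is to bound both sides by three
  vertices.\<close>

lemma leaf_at_small_vertex:
  assumes l: "l \<in> P" "leaf l c"
    and no_big: "\<not> (\<exists>l c p p2. leaf l c \<and> c \<rightarrow> p \<and> c \<rightarrow> p2 \<and> p \<noteq> p2 \<and> p \<noteq> l \<and> p2 \<noteq> l)"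
  shows "\<exists>xs. length xs = 6 \<and> realizes G xs path6_edges"
proof -
  have small: False if "leaf l c" "c \<rightarrow> p" "c \<rightarrow> p2" "p \<noteq> p2" "p \<noteq> l" "p2 \<noteq> l" for l c p p2
    using no_big that by blast
  have c: "c \<in> Q" using leaf_adj(1)[OF l(2)] l(1) adj_P by blast
  have "\<exists>p. c \<rightarrow> p \<and> p \<noteq> l"
  proof (rule ccontr)
    assume "\<not> ?thesis"
    then have "{l, c} = verts G"
      using leaf_adj(4)[OF l(2)] l(1) c sides(1) by (intro connD[OF conn]) auto
    then have "P = {l}" using l(1) c sides by auto
    then show False using not_dominating_Q[OF c] leaf_adj(2)[OF l(2)] by blast
  qed
  then obtain p where p: "c \<rightarrow> p" "p \<noteq> l" by blast
  have Nc: "c \<rightarrow> u \<longleftrightarrow> u = l \<or> u = p" for u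
    using small[OF l(2), of p u] p leaf_adj(2)[OF l(2)] by blast
  have pP: "p \<in> P" using p c adj_Q by blast
  have "conn (verts G - {l})" using conn_remove_leaf[OF conn l(2)] .
  then obtain d where d: "d \<in> Q" "\<forall>p. d \<rightarrow> p \<longleftrightarrow> p \<in> P - {l}"
    using nearly_dominating_P l(1) by blast
  have "d \<noteq> c" using d(2) leaf_adj(2)[OF l(2)] by blast
  have "d \<rightarrow> p" using d(2) pP p(2) by blast
  obtain x where x: "x \<in> P" "\<not> c \<rightarrow> x" using not_dominating_Q[OF c] by blast
  have "x \<noteq> l" "x \<noteq> p" using x Nc by blast+
  have "d \<rightarrow> x" using d(2) x(1) \<open>x \<noteq> l\<close> by blast
  \<comment> \<open>If some vertex of \<open>P\<close> other than l is not a cut vertex, its partner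
    is c, whose neighbors are only l and p. Otherwise every vertex of \<open>P\<close> except l and
    p carries a leaf. The partner of the leaf q at x is then p, and p would be adjacent to the leaf
    at any fourth vertex.\<close>
  have P: "P = {l, p, x}"
  proof (cases "\<exists>x' \<in> P - {l}. conn (verts G - {x'})")
    case True
    then obtain x' where x': "x' \<in> P" "x' \<noteq> l" "conn (verts G - {x'})" by blast
    then obtain y where y: "y \<in> Q" "\<forall>p. y \<rightarrow> p \<longleftrightarrow> p \<in> P - {x'}" using nearly_dominating_P by blast
    then have "y = c" using l(1) x'(2) leaf_adj(3)[OF l(2)] by blast
    then have "u = l \<or> u = p \<longleftrightarrow> u \<in> P - {x'}" for u using y(2) Nc by blast
    then show ?thesis using x'(1) x(1) \<open>x \<noteq> l\<close> \<open>x \<noteq> p\<close> by blast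
  next
    case False
    then have leaf: "\<exists>q \<in> Q. leaf q x'" if "x' \<in> P" "x' \<noteq> l" "x' \<noteq> p" for x'
      using cut_vertex_has_leaf[OF d l(2) that(1,2) pP p(2) _ p(1)] that by blast
    obtain q where q: "q \<in> Q" "leaf q x" using leaf[OF x(1) \<open>x \<noteq> l\<close> \<open>x \<noteq> p\<close>] by blast
    have "conn (verts G - {q})" using conn_remove_leaf[OF conn q(2)] .
    then obtain d' where d': "d' \<in> P" "\<forall>z. d' \<rightarrow> z \<longleftrightarrow> z \<in> Q - {q}"
      using nearly_dominating_Q q(1) by blast
    have "q \<noteq> c" "q \<noteq> d" using leaf_adj(4)[OF q(2)] p(1) \<open>d \<rightarrow> p\<close> \<open>x \<noteq> p\<close> by blast+
    then have "d' \<rightarrow> c" "d' \<rightarrow> d" using d'(2) c d(1) by blast+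
    then have "d' = p" using Nc adj_sym leaf_adj(4)[OF l(2)] \<open>d \<noteq> c\<close> by blast
    have "u \<in> {l, p, x}" if u: "u \<in> P" for u
    proof (rule ccontr)
      assume "u \<notin> {l, p, x}"
      then have u': "u \<noteq> l" "u \<noteq> p" "u \<noteq> x" by auto
      then obtain z where z: "z \<in> Q" "leaf z u" using leaf[OF u] by blast
      then have "z \<noteq> q" using q(2) leaf_adj(1) leaf_adj(4) u'(3) by blast
      then have "p \<rightarrow> z" using d'(2) z(1) \<open>d' = p\<close> by blast
      then show False using leaf_adj(3)[OF z(2)] u'(2) by blast
    qed
    then show ?thesis using l(1) pP x(1) by blast
  qed
  obtain z where z: "z \<in> Q" "\<not> p \<rightarrow> z" using not_dominating_P[OF pP] by blast
  have "z \<noteq> c" "z \<noteq> d" using z(2) adj_sym[OF p(1)] adj_sym[OF \<open>d \<rightarrow> p\<close>] by blast+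
  have px: "v = p \<or> v = x" if "u \<in> Q" "u \<noteq> c" "u \<rightarrow> v" for u v
  proof -
    have "v \<in> P" using that adj_Q by blast
    moreover have "v \<noteq> l" using that leaf_adj(3)[OF l(2)] by blast
    ultimately show ?thesis using P by blast
  qed
  have "leaf z x"
  proof -
    have "v = x" if "z \<rightarrow> v" for v using px[OF z(1) \<open>z \<noteq> c\<close> that] that z(2) adj_sym by blast
    moreover obtain v where "z \<rightarrow> v" using has_neighbor z(1) sides(1) by blast
    ultimately show ?thesis unfolding leaf_def by blast
  qed
  have "u \<in> {c, d, z}" if u: "u \<in> Q" for u
  proof (rule ccontr)
    assume "u \<notin> {c, d, z}"
    then have u': "u \<noteq> c" "u \<noteq> d" "u \<noteq> z" by auto
    \<comment> \<open>The leaf z leaves x only one other neighbor, which is d. So u would be a leaf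
      at p, which already has the two neighbors c and d.\<close>
    have "\<not> x \<rightarrow> u" using small[OF \<open>leaf z x\<close> _ adj_sym[OF \<open>d \<rightarrow> x\<close>], of u] u' \<open>z \<noteq> d\<close> by blast
    then have "v = p" if "u \<rightarrow> v" for v using px[OF u u'(1) that] that adj_sym by blast
    moreover obtain v where "u \<rightarrow> v" using has_neighbor u sides(1) by blast
    ultimately have "leaf u p" unfolding leaf_def by blast
    then show False
      using small[OF _ adj_sym[OF p(1)] adj_sym[OF \<open>d \<rightarrow> p\<close>], of u] u' \<open>d \<noteq> c\<close> by blast
  qed
  then have Q: "Q = {c, d, z}" using c d(1) z(1) by blast
  let ?xs = "[l, c, p, d, x, z]"
  have "P \<inter> Q = {}" using sides by simp
  then have "distinct ?xs"
    using P Q p(2) \<open>x \<noteq> l\<close> \<open>x \<noteq> p\<close> \<open>d \<noteq> c\<close> \<open>z \<noteq> c\<close> \<open>z \<noteq> d\<close> by auto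
  have Nd: "d \<rightarrow> u \<longleftrightarrow> u = p \<or> u = x" for u using d(2) P p(2) \<open>x \<noteq> l\<close> by blast
  have Nz: "z \<rightarrow> u \<longleftrightarrow> u = x" for u using \<open>leaf z x\<close> unfolding leaf_def by blast
  have "realizes G ?xs path6_edges"
  proof (rule realizesI[OF \<open>distinct ?xs\<close> _ refl])
    show "set ?xs = P \<union> Q" using P Q by auto
    fix q u assume "q \<in> Q"
    then have "q \<in> {c, d, z}" using Q by simp
    then show "q \<rightarrow> u \<longleftrightarrow> (q, u) \<in> set (map (\<lambda>(i, j). (?xs ! i, ?xs ! j)) path6_edges)"
      using Nc Nd Nz \<open>distinct ?xs\<close> unfolding path6_edges_def by auto
  qed (auto simp: P Q path6_edges_def)
  moreover have "length ?xs = 6" by simp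
  ultimately show ?thesis by blast
qed

end

section \<open>Bipartite critical graphs without cut vertices\<close>

context bipartite_critical
begin

text \<open>The partner of x misses exactly x within \<open>P\<close>, so it determines x. The
  injections obtained in both directions force equal sizes and make \<open>m\<close> a
  bijection.\<close>

lemma matching_if_no_cut_vertex:
  assumes "\<And>x. x \<in> verts G \<Longrightarrow> conn (verts G - {x})"
  shows "\<exists>m. bij_betw m P Q \<and> (\<forall>p \<in> P. \<forall>q \<in> Q. p \<rightarrow> q \<longleftrightarrow> q \<noteq> m p)"
proof -
  have "\<forall>x \<in> P. \<exists>y. y \<in> Q \<and> (\<forall>p. y \<rightarrow> p \<longleftrightarrow> p \<in> P - {x})"
  proof
    fix x assume "x \<in> P"
    moreover from this have "conn (verts G - {x})" using assms sides(1) by simp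
    ultimately show "\<exists>y. y \<in> Q \<and> (\<forall>p. y \<rightarrow> p \<longleftrightarrow> p \<in> P - {x})"
      using nearly_dominating_P by blast
  qed
  from bchoice[OF this] obtain m where m: "\<And>x. x \<in> P \<Longrightarrow> m x \<in> Q" "\<And>x p. x \<in> P \<Longrightarrow> m x \<rightarrow> p \<longleftrightarrow> p \<in> P - {x}"
    by blast
  have "\<forall>x \<in> Q. \<exists>y. y \<in> P \<and> (\<forall>q. y \<rightarrow> q \<longleftrightarrow> q \<in> Q - {x})"
  proof
    fix x assume "x \<in> Q"
    moreover from this have "conn (verts G - {x})" using assms sides(1) by simp
    ultimately show "\<exists>y. y \<in> P \<and> (\<forall>q. y \<rightarrow> q \<longleftrightarrow> q \<in> Q - {x})"
      using nearly_dominating_Q by blast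
  qed
  from bchoice[OF this] obtain n where n: "\<And>x. x \<in> Q \<Longrightarrow> n x \<in> P" "\<And>x q. x \<in> Q \<Longrightarrow> n x \<rightarrow> q \<longleftrightarrow> q \<in> Q - {x}"
    by blast
  have fin: "finite P" "finite Q" using sides(1) finite_verts by (metis finite_Un)+
  have inj_m: "inj_on m P" using m(2) unfolding inj_on_def by (metis Diff_iff singletonD singletonI)
  have inj_n: "inj_on n Q" using n(2) unfolding inj_on_def by (metis Diff_iff singletonD singletonI)
  have "card P \<le> card Q" using card_inj_on_le[OF inj_m] m(1) fin by blast
  moreover have "card Q \<le> card P" using card_inj_on_le[OF inj_n] n(1) fin by blast
  ultimately have "m ` P = Q"
    using m(1) fin inj_m by (intro card_subset_eq) (auto simp: card_image)
  then have bij: "bij_betw m P Q" using inj_m unfolding bij_betw_def by simp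
  moreover have "p \<rightarrow> q \<longleftrightarrow> q \<noteq> m p" if pq: "p \<in> P" "q \<in> Q" for p q
  proof -
    obtain x where x: "x \<in> P" "q = m x" using pq(2) \<open>m ` P = Q\<close> by blast
    then have "p \<rightarrow> q \<longleftrightarrow> p \<noteq> x" using m(2)[OF x(1), of p] pq(1) adj_sym by blast
    then show ?thesis using inj_onD[OF inj_m, of p x] x pq(1) by auto
  qed
  ultimately show ?thesis by blast
qed

lemma three_le_card:
  assumes "bij_betw m P Q" "\<And>p q. p \<in> P \<Longrightarrow> q \<in> Q \<Longrightarrow> p \<rightarrow> q \<longleftrightarrow> q \<noteq> m p" "verts G \<noteq> {}"
  shows "3 \<le> card P"
proof -
  have fin: "finite P" "finite Q" using sides(1) finite_verts by (metis finite_Un)+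
  have adj: "m p \<noteq> m p' \<longleftrightarrow> p \<noteq> p'" if "p \<in> P" "p' \<in> P" for p p'
    using that assms(1) unfolding bij_betw_def inj_on_def by blast
  have mQ: "Q = m ` P" using assms(1) unfolding bij_betw_def by blast
  have "P \<noteq> {}" using mQ sides(1) assms(3) by auto
  then obtain a where a: "a \<in> P" by blast
  have "\<exists>v. a \<rightarrow> v" using has_neighbor a sides(1) by blast
  then obtain v where "a \<rightarrow> v" "v \<in> Q" using adj_P a by blast
  then obtain b where b: "b \<in> P" "b \<noteq> a" using assms(2)[OF a] mQ by blast
  have "P \<noteq> {a, b}"
  proof
    assume P: "P = {a, b}"
    have Q: "Q = {m a, m b}" using P mQ by auto
    \<comment> \<open>With two vertices on each side the graph would be two disjoint edges, and one
      of them would be a closed set.\<close>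
    have "{a, m b} = verts G"
    proof (rule connD[OF conn])
      fix u v assume uv: "u \<in> {a, m b}" "u \<rightarrow> v"
      show "v \<in> {a, m b}"
      proof (cases "u = a")
        case True
        then show ?thesis using uv assms(2)[OF a] adj_P[of u v] a Q by blast
      next
        case False
        then have u: "u = m b" "u \<in> Q" using uv(1) Q by auto
        then have "v \<in> P" using uv(2) adj_Q by blast
        moreover have "v \<noteq> b" using assms(2)[OF b(1) u(2)] u(1) uv(2) adj_sym by blast
        ultimately show ?thesis using P by blast
      qed
    qed (use a Q sides in auto)
    moreover have "b \<noteq> m b" using sides(2) b(1) Q by blast
    ultimately show False using b sides(1) by auto
  qed
  then obtain c where "c \<in> P" "c \<noteq> a" "c \<noteq> b" using a b(1) by blast
  then have "card {a, b, c} = 3" "{a, b, c} \<subseteq> P" using a b by auto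
  then show ?thesis using card_mono[OF fin(1)] by metis
qed

lemma card_le_6_if_matching:
  assumes "bij_betw m P Q" "\<And>p q. p \<in> P \<Longrightarrow> q \<in> Q \<Longrightarrow> p \<rightarrow> q \<longleftrightarrow> q \<noteq> m p"
    and "st Bob = Alice" "rounds_left st G (verts G) {} Alice \<le> 3"
  shows "card (verts G) \<le> 6"
proof -
  define n where "n = inv_into P m"
  \<comment> \<open>The involution exchanging matched vertices on both sides, which serves as Bob's
    answer.\<close>
  define f where "f v = (if v \<in> P then m v else n v)" for v
  have mQ: "m p \<in> Q" if "p \<in> P" for p using that assms(1) bij_betwE by blast
  have nP: "n q \<in> P" if "q \<in> Q" for q
    using that assms(1) bij_betw_inv_into bij_betwE unfolding n_def by blast
  have mn: "m (n q) = q" if "q \<in> Q" for q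
    using that bij_betw_inv_into_right[OF assms(1)] unfolding n_def by simp
  have nm: "n (m p) = p" if "p \<in> P" for p
    using that bij_betw_inv_into_left[OF assms(1)] unfolding n_def by simp
  have notP: "q \<notin> P" if "q \<in> Q" for q using that sides(2) by blast
  have fP: "f p = m p" if "p \<in> P" for p using that unfolding f_def by simp
  have fQ: "f q = n q" if "q \<in> Q" for q using that notP unfolding f_def by simp
  have "card (verts G) \<le> 2 * rounds_left st G (verts G) {} Alice"
  proof (rule rounds_left_mirror[where m = f])
    fix v assume "v \<in> verts G"
    then consider "v \<in> P" | "v \<in> Q" using sides(1) by blast
    then show "f v \<in> verts G \<and> f v \<noteq> v \<and> \<not> v \<rightarrow> f v \<and> f (f v) = v"
    proof cases
      case 1
      then have "f v \<in> Q" "f (f v) = v" "\<not> v \<rightarrow> f v"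
        using fP[OF 1] fQ[OF mQ[OF 1]] mQ[OF 1] nm[OF 1] assms(2)[OF 1 mQ[OF 1]] by simp_all
      then show ?thesis using 1 notP[of "f v"] sides(1) by auto
    next
      case 2
      then have "f v \<in> P" "f (f v) = v" "\<not> f v \<rightarrow> v"
        using fQ[OF 2] fP[OF nP[OF 2]] nP[OF 2] mn[OF 2] assms(2)[OF nP[OF 2] 2] by simp_all
      then show ?thesis using 2 notP[of v] sides(1) adj_sym[of v "f v"] by auto
    qed
  next
    fix v w assume "v \<in> verts G" "w \<in> verts G" and w: "w \<noteq> v" "w \<noteq> f v"
    then consider "v \<in> P" "w \<in> Q" | "v \<in> Q" "w \<in> P" | "v \<in> P" "w \<in> P" | "v \<in> Q" "w \<in> Q"
      using sides(1) by blast
    then show "v \<rightarrow> w \<or> f v \<rightarrow> w"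
    proof cases
      case 1
      then show ?thesis using assms(2) fP w by auto
    next
      case 2
      then have "v \<noteq> m w" using fQ[OF 2(1)] nm w(2) by auto
      then show ?thesis using assms(2) 2 adj_sym by blast
    next
      case 3
      then have "f v \<noteq> m w" using fP nm w(1) by metis
      then show ?thesis using assms(2)[OF 3(2) mQ[OF 3(1)]] fP[OF 3(1)] adj_sym by auto
    next
      case 4
      then have "w \<noteq> m (f v)" using fQ mn w(1) by simp
      then show ?thesis using assms(2)[OF nP[OF 4(1)] 4(2)] fQ[OF 4(1)] by auto
    qed
  qed (use assms in auto)
  then show ?thesis using assms(4) by linarith
qed

lemma bipartite_critical_classification:
  assumes "st Bob = Alice" "rounds_left st G (verts G) {} Alice \<le> 3" "verts G \<noteq> {}"
  shows "(\<exists>xs. length xs = 6 \<and> realizes G xs path6_edges) \<or>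
    (\<exists>xs. length xs = 6 \<and> realizes G xs cycle6_edges) \<or>
    (\<exists>xs. length xs = 8 \<and> realizes G xs sun4_edges)"
proof (cases "\<exists>l c. leaf l c")
  case True
  interpret swap: bipartite_critical G Q P by (rule swap_sides)
  have side: "l \<in> P \<or> l \<in> Q" if "leaf l c" for l c
    using leaf_adj(1)[OF that] adj_in_verts sides(1) by blast
  show ?thesis
  proof (cases "\<exists>l c p p2. leaf l c \<and> c \<rightarrow> p \<and> c \<rightarrow> p2 \<and> p \<noteq> p2 \<and> p \<noteq> l \<and> p2 \<noteq> l")
    case True
    then obtain l c p p2 where
      *: "leaf l c" "c \<rightarrow> p" "c \<rightarrow> p2" "p \<noteq> p2" "p \<noteq> l" "p2 \<noteq> l" by blast
    show ?thesis
      using side[OF *(1)] leaf_at_big_vertex[OF _ *] swap.leaf_at_big_vertex[OF _ *] by blast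
  next
    case False
    obtain l c where l: "leaf l c" using \<open>\<exists>l c. leaf l c\<close> by blast
    show ?thesis
      using side[OF l] leaf_at_small_vertex[OF _ l False] swap.leaf_at_small_vertex[OF _ l False] by blast
  qed
next
  case False
  interpret swap: bipartite_critical G Q P by (rule swap_sides)
  have "conn (verts G - {x})" if x: "x \<in> verts G" for x
  proof (rule ccontr)
    assume "\<not> ?thesis"
    then obtain c S where S: "separates c S" "\<forall>c' S'. separates c' S' \<longrightarrow> card S \<le> card S'"
      using minimal_separated[OF x] by blast
    then have "c \<in> P \<or> c \<in> Q" using sides(1) unfolding separates_def by blast
    then show False using leaf_in_minimal_separated[OF S] swap.leaf_in_minimal_separated[OF S] False by blast
  qed
  then obtain m where m: "bij_betw m P Q" "\<And>p q. p \<in> P \<Longrightarrow> q \<in> Q \<Longrightarrow> p \<rightarrow> q \<longleftrightarrow> q \<noteq> m p"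
    using matching_if_no_cut_vertex by blast
  have "finite P" "finite Q" using sides(1) finite_verts by (metis finite_Un)+
  then have "card (verts G) = card P + card Q" using sides by (simp add: card_Un_disjoint)
  then have "card P = 3"
    using card_le_6_if_matching[OF m assms(1,2)] three_le_card[OF m assms(3)] bij_betw_same_card[OF m(1)]
    by linarith
  then show ?thesis using mirror_realizes_cycle6 m by blast
qed

end

section \<open>From criticality to the list of five graphs\<close>

context graph
begin

lemma critical_classification:
  assumes conn: "conn (verts G)" and st: "st Bob = Alice"
    and three: "rounds_left st G (verts G) {} Alice = 3"
    and crit: "\<And>x. x \<in> verts G \<Longrightarrow> rounds_left st G (verts G - {x}) {} Alice \<le> 2"
  shows "(\<exists>xs. length xs = 3 \<and> realizes G xs cycle3_edges) \<or>
    (\<exists>xs. length xs = 5 \<and> realizes G xs cycle5_edges) \<or>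
    (\<exists>xs. length xs = 6 \<and> realizes G xs path6_edges) \<or>
    (\<exists>xs. length xs = 6 \<and> realizes G xs cycle6_edges) \<or>
    (\<exists>xs. length xs = 8 \<and> realizes G xs sun4_edges)"
proof -
  have ne: "verts G \<noteq> {}" using three by auto
  have no_dom: "\<not> dominator (verts G) v" for v
    using rounds_left_safe_move[OF _ dominator_safe_move, of "verts G" v st] three by auto
  have bip: "bipartite (verts G - {x})" if "x \<in> verts G" for x
    using bipartite_of_rounds_left_le_2[OF _ crit[OF that]] by simp
  have dom: "\<exists>y. dominator (verts G - {x}) y"
    if x: "x \<in> verts G" "conn (verts G - {x})" for x
  proof -
    have "verts G - {x} \<noteq> {}"
    proof
      assume "verts G - {x} = {}"
      then have "verts G = {x}" using x by blast
      then have "dominator (verts G) x" unfolding dominator_def indep_def by auto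
      then show False using no_dom by blast
    qed
    then show ?thesis
      using dominator_of_rounds_left_le_2[OF _ _ x(2) crit[OF x(1)]] finite_verts by blast
  qed
  show ?thesis
  proof (cases "bipartite (verts G)")
    case False
    obtain x where x: "x \<in> verts G" "conn (verts G - {x})" using conn_remove_exists[OF ne conn] by blast
    obtain v where "dominator (verts G - {x}) v" using dom[OF x] by blast
    then show ?thesis using nonbipartite_critical[OF bip False x] by blast
  next
    case True
    \<comment> \<open>The bipartition of the connected G - x is unique, so the dominator y is
      adjacent to its whole opposite side there. If y were in \<open>P\<close>, or in
      \<open>Q\<close> and adjacent to x, it would also be a dominator of G and two rounds would
      suffice.\<close>
    have nearly: "\<exists>y \<in> Q. \<forall>p. y \<rightarrow> p \<longleftrightarrow> p \<in> P - {x}"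
      if PQ: "verts G = P \<union> Q" "P \<inter> Q = {}" "indep P" "indep Q"
        and x: "x \<in> P" "conn (verts G - {x})" for P Q x
    proof -
      let ?W = "verts G - {x}"
      obtain y where y: "dominator ?W y" using dom x PQ(1) by blast
      let ?N = "{u \<in> ?W. \<not> y \<rightarrow> u}"
      have "?W - ?N = {u \<in> ?W. y \<rightarrow> u}" by blast
      then have yW: "y \<in> ?W" "?N \<subseteq> ?W" "indep ?N" "indep (?W - ?N)" "y \<in> ?N"
        using y unfolding dominator_def by auto
      have sub: "P - {x} \<subseteq> ?W" "Q \<subseteq> ?W" "?W - (P - {x}) = Q" "?W - Q = P - {x}"
        using PQ(1,2) x(1) by auto
      have "indep (P - {x})" using PQ(3) indep_subset by blast
      show ?thesis
      proof (cases "y \<in> P")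
        case True
        then have "?N = P - {x}"
          using bipartition_unique[OF x(2) yW(2) sub(1) yW(3,4) \<open>indep (P - {x})\<close> _ yW(5)] sub(3) PQ(4) yW(1)
          by auto
        then have "y \<rightarrow> q" if "q \<in> Q" for q using that sub(2) PQ(2) by blast
        moreover have "\<not> y \<rightarrow> p" if "p \<in> P" for p using that True PQ(3) unfolding indep_def by blast
        ultimately have "{u \<in> verts G. y \<rightarrow> u} = Q" "{u \<in> verts G. \<not> y \<rightarrow> u} = P"
          using PQ(1) by auto
        then have "dominator (verts G) y" using PQ(3,4) yW(1) unfolding dominator_def by simp
        then show ?thesis using no_dom by blast
      next
        case False
        then have yQ: "y \<in> Q" using yW(1) PQ(1) by blast
        then have N: "?N = Q"
          using bipartition_unique[OF x(2) yW(2) sub(2) yW(3,4) PQ(4) _ yW(5)] sub(4) \<open>indep (P - {x})\<close>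
          by auto
        then have adj: "y \<rightarrow> p" if "p \<in> P - {x}" for p using that sub(1) PQ(2) by blast
        have nonadj: "\<not> y \<rightarrow> q" if "q \<in> Q" for q using that yQ PQ(4) unfolding indep_def by blast
        have "\<not> y \<rightarrow> x"
        proof
          assume "y \<rightarrow> x"
          then have "{u \<in> verts G. y \<rightarrow> u} = P" "{u \<in> verts G. \<not> y \<rightarrow> u} = Q"
            using adj nonadj PQ(1) by auto
          then have "dominator (verts G) y" using PQ(3,4) yW(1) unfolding dominator_def by simp
          then show False using no_dom by blast
        qed
        then have "y \<rightarrow> p \<longleftrightarrow> p \<in> P - {x}" for p
          using adj nonadj adj_in_verts[of y p] PQ(1) by blast
        then show ?thesis using yQ by blast
      qed
    qed
    have not_dominating: "\<exists>q \<in> Q. \<not> p \<rightarrow> q"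
      if PQ: "verts G = P \<union> Q" "P \<inter> Q = {}" "indep P" "indep Q" and p: "p \<in> P" for P Q p
    proof (rule ccontr)
      assume "\<not> ?thesis"
      moreover have "\<not> p \<rightarrow> u" if "u \<in> P" for u using that p PQ(3) unfolding indep_def by blast
      ultimately have "{u \<in> verts G. p \<rightarrow> u} = Q" "{u \<in> verts G. \<not> p \<rightarrow> u} = P"
        using PQ(1,2) by auto
      then have "dominator (verts G) p" using PQ p unfolding dominator_def by simp
      then show False using no_dom by blast
    qed
    obtain P where P: "P \<subseteq> verts G" "indep P" "indep (verts G - P)"
      using True unfolding bipartite_def by blast
    let ?Q = "verts G - P"
    have PQ: "verts G = P \<union> ?Q" "P \<inter> ?Q = {}" and QP: "verts G = ?Q \<union> P" "?Q \<inter> P = {}"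
      using P(1) by auto
    interpret bipartite_critical G P ?Q
    proof (intro bipartite_critical.intro bipartite_critical_axioms.intro)
      show "bipartition G P ?Q" by unfold_locales (use PQ P(2,3) in auto)
      show "conn (verts G)" by (fact conn)
    next
      fix p assume "p \<in> P"
      then show "\<exists>q \<in> ?Q. \<not> p \<rightarrow> q" by (rule not_dominating[OF PQ P(2,3)])
    next
      fix q assume "q \<in> ?Q"
      then show "\<exists>p \<in> P. \<not> q \<rightarrow> p" by (rule not_dominating[OF QP P(3,2)])
    next
      fix x assume "x \<in> P" "conn (verts G - {x})"
      then show "\<exists>y \<in> ?Q. \<forall>p. y \<rightarrow> p \<longleftrightarrow> p \<in> P - {x}" by (rule nearly[OF PQ P(2,3)])
    next
      fix x assume "x \<in> ?Q" "conn (verts G - {x})"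
      then show "\<exists>y \<in> P. \<forall>q. y \<rightarrow> q \<longleftrightarrow> q \<in> ?Q - {x}" by (rule nearly[OF QP P(3,2)])
    qed
    show ?thesis using bipartite_critical_classification[of st] st ne three by simp
  qed
qed

end

section \<open>Deciding the game on small graphs\<close>

definition adj_in :: "(nat \<times> nat) list \<Rightarrow> nat \<Rightarrow> nat \<Rightarrow> bool" where
  "adj_in es u v \<longleftrightarrow> (u, v) \<in> set es \<or> (v, u) \<in> set es"

definition indep_in :: "(nat \<times> nat) list \<Rightarrow> nat list \<Rightarrow> bool" where
  "indep_in es S \<longleftrightarrow> (\<forall>(u, v) \<in> set es. \<not> (u \<in> set S \<and> v \<in> set S))"

definition max_indep_in :: "(nat \<times> nat) list \<Rightarrow> nat list \<Rightarrow> nat list \<Rightarrow> bool" where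
  "max_indep_in es us S \<longleftrightarrow>
     indep_in es S \<and> (\<forall>v \<in> set us. v \<in> set S \<or> (\<exists>u \<in> set S. adj_in es u v))"

definition minus_in :: "nat list \<Rightarrow> nat list \<Rightarrow> nat list" where
  "minus_in us S = filter (\<lambda>u. u \<notin> set S) us"

text \<open>The vertices left over after any round on \<open>us\<close> in which \<open>v\<close> is colored satisfy \<open>ok\<close>.\<close>

definition rounds_from_in ::
  "(nat \<times> nat) list \<Rightarrow> nat list \<Rightarrow> nat \<Rightarrow> (nat list \<Rightarrow> bool) \<Rightarrow> bool" where
  "rounds_from_in es us v ok \<longleftrightarrow>
     (\<forall>S \<in> set (subseqs (filter (\<lambda>u. u \<noteq> v \<and> \<not> adj_in es v u) us)).
        max_indep_in es us (v # S) \<longrightarrow> ok (minus_in us (v # S)))"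

definition two_rounds_in :: "(nat \<times> nat) list \<Rightarrow> nat list \<Rightarrow> bool" where
  "two_rounds_in es us \<longleftrightarrow>
     (\<forall>S \<in> set (subseqs us). max_indep_in es us S \<longrightarrow> indep_in es (minus_in us S))"

text \<open>An edge whose ends are both neighbors or both non-neighbors of v is a certificate that v
  is not a dominator.\<close>

definition undominated_in :: "(nat \<times> nat) list \<Rightarrow> nat list \<Rightarrow> bool" where
  "undominated_in es us \<longleftrightarrow>
     (\<forall>v \<in> set us. \<exists>(u, w) \<in> set es. adj_in es v u \<longleftrightarrow> adj_in es v w)"

text \<open>Descending along such neighbors ends in \<open>0\<close>, so the graph is connected.\<close>

definition descending_in :: "(nat \<times> nat) list \<Rightarrow> nat list \<Rightarrow> bool" where
  "descending_in es us \<longleftrightarrow> (\<forall>i \<in> set us. i = 0 \<or> (\<exists>j \<in> set us. j < i \<and> adj_in es i j))"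

text \<open>The vertex lists are numbered so that 0 is an opening securing three rounds in all five
  graphs. For the vertex-deleted graphs a suitable opening is searched for.\<close>

definition critical_bounds_in :: "(nat \<times> nat) list \<Rightarrow> nat list \<Rightarrow> bool" where
  "critical_bounds_in es us \<longleftrightarrow> rounds_from_in es us 0 (two_rounds_in es) \<and>
     (\<forall>x \<in> set us. \<exists>v \<in> set us. v \<noteq> x \<and> rounds_from_in es (removeAll x us) v (indep_in es))"

text \<open>The evaluation enumerates maximal independent sets instead of the game tree, so one
  computation covers both games.\<close>

lemma critical_bounds_small:
  "critical_bounds_in cycle3_edges [0, 1, 2]"
  "critical_bounds_in cycle5_edges [0, 1, 2, 3, 4]"
  "critical_bounds_in path6_edges [0, 1, 2, 3, 4, 5]"
  "critical_bounds_in cycle6_edges [0, 1, 2, 3, 4, 5]"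
  by code_simp+

lemma critical_bounds_sun4: "critical_bounds_in sun4_edges [0, 1, 2, 3, 4, 5, 6, 7]"
  by code_simp

lemma undominated_small:
  "undominated_in path6_edges [0, 1, 2, 3, 4, 5] \<and> descending_in path6_edges [0, 1, 2, 3, 4, 5]"
  "undominated_in cycle6_edges [0, 1, 2, 3, 4, 5] \<and> descending_in cycle6_edges [0, 1, 2, 3, 4, 5]"
  "undominated_in sun4_edges [0, 1, 2, 3, 4, 5, 6, 7] \<and> descending_in sun4_edges [0, 1, 2, 3, 4, 5, 6, 7]"
  by code_simp+

text \<open>Criticality with G fixed and only the playing field shrunk, for an arbitrary rule
  \<open>st\<close>.\<close>

definition critical_for :: "(player \<Rightarrow> player) \<Rightarrow> ('a, 'b) pre_digraph \<Rightarrow> bool" where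
  "critical_for st G \<longleftrightarrow> rounds_left st G (verts G) {} Alice = 3 \<and>
     (\<forall>x \<in> verts G. rounds_left st G (verts G - {x}) {} Alice \<le> 2)"

section \<open>Transfer from list computations to the game\<close>

locale list_graph = graph G for G :: "(nat, 'b) pre_digraph" (structure) +
  fixes es :: "(nat \<times> nat) list" and us :: "nat list"
  assumes adj: "u \<rightarrow> v \<longleftrightarrow> adj_in es u v"
    and verts: "verts G = set us" and zero: "0 \<in> set us"
begin

lemma indep_in_iff: "indep_in es S \<longleftrightarrow> indep (set S)"
  unfolding indep_in_def indep_def adj adj_in_def
  by auto

lemma max_indep_in_iff: "set S \<subseteq> set vs \<Longrightarrow> max_indep_in es vs S \<longleftrightarrow> max_indep (set vs) (set S)"
  unfolding max_indep_in_def max_indep_def indep_in_iff adj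
  by auto

lemma set_minus_in [simp]: "set (minus_in vs S) = set vs - set S"
  unfolding minus_in_def by auto

lemma rounds_from_inD:
  assumes "rounds_from_in es vs v ok" "max_indep (set vs) I" "v \<in> I"
  shows "\<exists>ws. set ws = set vs - I \<and> ok ws"
proof -
  have I: "I \<subseteq> set vs" "indep I" using assms(2) unfolding max_indep_def by auto
  then have "I - {v} \<subseteq> set (filter (\<lambda>u. u \<noteq> v \<and> \<not> adj_in es v u) vs)"
    using assms(3) unfolding indep_def adj by auto
  then obtain S where S: "S \<in> set (subseqs (filter (\<lambda>u. u \<noteq> v \<and> \<not> adj_in es v u) vs))" "set S = I - {v}"
    using subseqs_powset by (metis (no_types, lifting) PowI imageE)
  then have vS: "set (v # S) = I" using assms(3) by auto
  then have "max_indep_in es vs (v # S)" using max_indep_in_iff[of "v # S" vs] assms(2) I(1) by simp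
  then have "ok (minus_in vs (v # S))"
    using assms(1) S(1) unfolding rounds_from_in_def by simp
  moreover have "set (minus_in vs (v # S)) = set vs - I" using vS by (simp only: set_minus_in)
  ultimately show ?thesis by blast
qed

lemma two_rounds_inD:
  assumes "two_rounds_in es vs" shows "rounds_left st G (set vs) {} p \<le> 2"
proof -
  have "rounds_left st G (set vs) {} p \<le> Suc 1"
  proof (rule rounds_left_upper)
    fix I q assume "max_indep (set vs \<union> {}) I"
    then have I: "max_indep (set vs) I" by simp
    then have "I \<subseteq> set vs" unfolding max_indep_def by blast
    then obtain S where S: "S \<in> set (subseqs vs)" "set S = I"
      using subseqs_powset by (metis PowI imageE)
    then have "max_indep_in es vs S" using max_indep_in_iff[of S vs] I \<open>I \<subseteq> set vs\<close> by simp
    then have "indep_in es (minus_in vs S)"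
      using assms S(1) unfolding two_rounds_in_def by simp
    then have "indep (set vs - I)" unfolding indep_in_iff using S(2) by simp
    then show "rounds_left st G (set vs \<union> {} - I) {} q \<le> 1" using rounds_left_le_1 by simp
  qed (auto simp: indep_def)
  then show ?thesis by simp
qed

lemma critical_bounds_inD:
  assumes "critical_bounds_in es us"
  shows "rounds_left st G (verts G) {} Alice \<le> 3"
    and "x \<in> verts G \<Longrightarrow> rounds_left st G (verts G - {x}) {} Alice \<le> 2"
proof -
  have first: "rounds_from_in es us 0 (two_rounds_in es)"
    using assms unfolding critical_bounds_in_def by simp
  have "rounds_left st G (verts G) {} Alice \<le> Suc 2"
    unfolding verts
  proof (rule rounds_left_first_move[OF _ zero])
    fix I q assume "0 \<in> I" "max_indep (set us) I"
    then show "rounds_left st G (set us - I) {} q \<le> 2"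
      using rounds_from_inD[OF first] two_rounds_inD by metis
  qed simp
  then show "rounds_left st G (verts G) {} Alice \<le> 3" by simp
next
  assume x: "x \<in> verts G"
  then obtain v where v: "v \<in> set us" "v \<noteq> x" "rounds_from_in es (removeAll x us) v (indep_in es)"
    using assms verts unfolding critical_bounds_in_def by auto
  have "safe_move (verts G - {x}) v"
    unfolding safe_move_def
  proof (intro conjI allI impI)
    fix I assume I: "v \<in> I" "max_indep (verts G - {x}) I"
    have eq: "set (removeAll x us) = verts G - {x}" using verts by simp
    show "indep (verts G - {x} - I)"
      using rounds_from_inD[OF v(3), of I] I indep_in_iff unfolding eq by auto
  qed (use v verts in simp)
  then show "rounds_left st G (verts G - {x}) {} Alice \<le> 2"
    by (intro rounds_left_safe_move) auto
qed

lemma three_rounds_if_undominated: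
  assumes "undominated_in es us" "descending_in es us"
  shows "\<not> rounds_left st G (verts G) {} Alice \<le> 2"
proof
  assume le: "rounds_left st G (verts G) {} Alice \<le> 2"
  have desc: "\<exists>j < i. i \<rightarrow> j" if "i \<in> verts G" "i \<noteq> 0" for i
    using assms(2) that verts adj unfolding descending_in_def by auto
  have "conn (verts G)"
    unfolding conn_def
  proof (intro allI impI)
    fix X assume X: "X \<subseteq> verts G" "X \<noteq> {}" "\<forall>u \<in> X. \<forall>v \<in> verts G. u \<rightarrow> v \<longrightarrow> v \<in> X"
    \<comment> \<open>Descending from the least element of a closed set shows that it is 0.
      Induction upward along the same edges then reaches every vertex.\<close>
    define m where "m = (LEAST i. i \<in> X)"
    have m: "m \<in> X" "\<And>j. j \<in> X \<Longrightarrow> m \<le> j"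
      using X(2) unfolding m_def by (auto intro: LeastI Least_le)
    have "m = 0"
    proof (rule ccontr)
      assume "m \<noteq> 0"
      then obtain j where j: "j < m" "m \<rightarrow> j" using desc[of m] m(1) X(1) by blast
      then have "j \<in> X" using X(3) m(1) adj_in_verts(2)[OF j(2)] by blast
      then show False using m(2) j(1) by fastforce
    qed
    have "i \<in> X" if "i \<in> verts G" for i
      using that
    proof (induction i rule: less_induct)
      case (less i)
      show ?case
      proof (cases "i = 0")
        case False
        then obtain j where j: "j < i" "i \<rightarrow> j" using desc less.prems by blast
        then have "j \<in> X" using less.IH adj_in_verts(2)[OF j(2)] by blast
        then show ?thesis using X(3) adj_sym[OF j(2)] less.prems by blast
      qed (use m(1) \<open>m = 0\<close> in simp)
    qed
    then show "X = verts G" using X(1) by blast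
  qed
  moreover have "verts G \<noteq> {}" using verts zero by auto
  ultimately obtain v where v: "dominator (verts G) v"
    using dominator_of_rounds_left_le_2[OF finite_verts _ _ le] by blast
  then have "v \<in> set us" using verts unfolding dominator_def by blast
  then obtain u w where uw: "(u, w) \<in> set es" "v \<rightarrow> u \<longleftrightarrow> v \<rightarrow> w"
    using assms(1) adj unfolding undominated_in_def by auto
  then have "u \<rightarrow> w" unfolding adj adj_in_def by simp
  moreover have "u \<in> verts G" "w \<in> verts G" using adj_in_verts[OF \<open>u \<rightarrow> w\<close>] .
  moreover have "indep {u \<in> verts G. v \<rightarrow> u}" "indep {u \<in> verts G. \<not> v \<rightarrow> u}"
    using v unfolding dominator_def by simp_all
  ultimately show False using uw(2) \<open>u \<rightarrow> w\<close> unfolding indep_def by (cases "v \<rightarrow> u") auto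
qed

lemma critical_forI:
  assumes "critical_bounds_in es us" "\<not> rounds_left st G (verts G) {} Alice \<le> 2"
  shows "critical_for st G"
  using critical_bounds_inD(1)[OF assms(1), of st] critical_bounds_inD(2)[OF assms(1), of _ st] assms(2)
  unfolding critical_for_def by auto

end

definition proper_edges :: "nat \<Rightarrow> (nat \<times> nat) list \<Rightarrow> bool" where
  "proper_edges n es \<longleftrightarrow> (\<forall>(i, j) \<in> set es. i < n \<and> j < n \<and> i \<noteq> j)"

definition edge_graph :: "nat \<Rightarrow> (nat \<times> nat) list \<Rightarrow> nat pair_pre_digraph" where
  "edge_graph n es = \<lparr> pverts = {..<n}, parcs = set es \<union> (set es)\<inverse> \<rparr>"

lemma list_graph_edge_graph:
  assumes "proper_edges n es" "0 < n"
  shows "list_graph (with_proj (edge_graph n es)) es [0..<n]"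
proof unfold_locales
  show "finite (arcs (with_proj (edge_graph n es)))" by (simp add: edge_graph_def)
  show "symmetric (with_proj (edge_graph n es))"
    by (auto simp: edge_graph_def symmetric_def intro: symI)
qed (use assms in \<open>auto simp: edge_graph_def proper_edges_def adj_in_def
    arc_to_ends_def\<close>)

lemma critical_edge_graphs:
  "critical_for st (with_proj (edge_graph 3 cycle3_edges))"
  "critical_for st (with_proj (edge_graph 5 cycle5_edges))"
  "critical_for st (with_proj (edge_graph 6 path6_edges))"
  "critical_for st (with_proj (edge_graph 6 cycle6_edges))"
  "critical_for st (with_proj (edge_graph 8 sun4_edges))"
proof -
  have upt: "[0..<3] = [0, 1, 2]" "[0..<5] = [0, 1, 2, 3, 4]" "[0..<6] = [0, 1, 2, 3, 4, 5]"
    "[0..<8] = [0, 1, 2, 3, 4, 5, 6, 7]"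
    by (simp_all add: upt_rec)
  interpret c3: list_graph "with_proj (edge_graph 3 cycle3_edges)" cycle3_edges "[0..<3]"
    by (rule list_graph_edge_graph) (auto simp: proper_edges_def edge_lists)
  interpret c5: list_graph "with_proj (edge_graph 5 cycle5_edges)" cycle5_edges "[0..<5]"
    by (rule list_graph_edge_graph) (auto simp: proper_edges_def edge_lists)
  interpret p6: list_graph "with_proj (edge_graph 6 path6_edges)" path6_edges "[0..<6]"
    by (rule list_graph_edge_graph) (auto simp: proper_edges_def edge_lists)
  interpret c6: list_graph "with_proj (edge_graph 6 cycle6_edges)" cycle6_edges "[0..<6]"
    by (rule list_graph_edge_graph) (auto simp: proper_edges_def edge_lists)
  interpret s4: list_graph "with_proj (edge_graph 8 sun4_edges)" sun4_edges "[0..<8]"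
    by (rule list_graph_edge_graph) (auto simp: proper_edges_def edge_lists)
  show "critical_for st (with_proj (edge_graph 3 cycle3_edges))"
  proof (rule c3.critical_forI)
    show "critical_bounds_in cycle3_edges [0..<3]" unfolding upt by (rule critical_bounds_small)
    \<comment> \<open>Two rounds would give a 2-coloring, which an odd cycle does not admit. The
      pentagon is treated in the same way.\<close>
    show "\<not> rounds_left st (with_proj (edge_graph 3 cycle3_edges))
      (verts (with_proj (edge_graph 3 cycle3_edges))) {} Alice \<le> 2"
      using c3.bipartite_of_rounds_left_le_2[OF c3.finite_verts, of st Alice]
        c3.not_bipartite_triangle[of "verts (with_proj (edge_graph 3 cycle3_edges))" 0 1 2]
      by (auto simp: edge_graph_def edge_lists)
  qed
  show "critical_for st (with_proj (edge_graph 5 cycle5_edges))"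
  proof (rule c5.critical_forI)
    show "critical_bounds_in cycle5_edges [0..<5]" unfolding upt by (rule critical_bounds_small)
    show "\<not> rounds_left st (with_proj (edge_graph 5 cycle5_edges))
      (verts (with_proj (edge_graph 5 cycle5_edges))) {} Alice \<le> 2"
      using c5.bipartite_of_rounds_left_le_2[OF c5.finite_verts, of st Alice]
        c5.not_bipartite_pentagon[of "verts (with_proj (edge_graph 5 cycle5_edges))" 0 1 2 3 4]
      by (auto simp: edge_graph_def edge_lists)
  qed
  show "critical_for st (with_proj (edge_graph 6 path6_edges))"
    using undominated_small critical_bounds_small
    by (intro p6.critical_forI p6.three_rounds_if_undominated) (simp_all only: upt)
  show "critical_for st (with_proj (edge_graph 6 cycle6_edges))"
    using undominated_small critical_bounds_small
    by (intro c6.critical_forI c6.three_rounds_if_undominated) (simp_all only: upt)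
  show "critical_for st (with_proj (edge_graph 8 sun4_edges))"
    using undominated_small critical_bounds_sun4
    by (intro s4.critical_forI s4.three_rounds_if_undominated) (simp_all only: upt)
qed

section \<open>Isomorphism\<close>

lemma realizes_arcs_ends:
  "realizes G xs es \<Longrightarrow> arcs_ends G = (\<lambda>(i, j). (xs ! i, xs ! j)) ` (set es \<union> (set es)\<inverse>)"
  unfolding realizes_def by (auto simp: Let_def image_iff)

lemma critical_for_if_realizes:
  assumes "realizes G xs es" "length xs = n" "proper_edges n es"
    and "critical_for st (with_proj (edge_graph n es))"
  shows "critical_for st G"
proof -
  let ?H = "with_proj (edge_graph n es)" and ?f = "(!) xs"
  have xs: "distinct xs" "verts G = set xs" using assms(1) unfolding realizes_def by auto
  have inj: "inj_on ?f {..<n}" using xs(1) assms(2) by (auto simp: inj_on_def nth_eq_iff_index_eq)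
  have img: "?f ` {..<n} = verts G" using xs(2) assms(2) by (auto simp: set_conv_nth)
  have adj: "?f i \<rightarrow>\<^bsub>G\<^esub> ?f j \<longleftrightarrow> i \<rightarrow>\<^bsub>?H\<^esub> j" if "i < n" "j < n" for i j
  proof
    assume "?f i \<rightarrow>\<^bsub>G\<^esub> ?f j"
    then obtain i' j' where e: "(i', j') \<in> set es \<union> (set es)\<inverse>" "xs ! i = xs ! i'" "xs ! j = xs ! j'"
      unfolding realizes_arcs_ends[OF assms(1)] by auto
    then have "i' < n" "j' < n" using assms(3) unfolding proper_edges_def by auto
    then have "i = i'" "j = j'" using e that xs(1) assms(2) by (auto simp: nth_eq_iff_index_eq)
    then show "i \<rightarrow>\<^bsub>?H\<^esub> j" using e(1) by (simp add: edge_graph_def)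
  next
    assume "i \<rightarrow>\<^bsub>?H\<^esub> j"
    then show "?f i \<rightarrow>\<^bsub>G\<^esub> ?f j"
      unfolding realizes_arcs_ends[OF assms(1)] by (force simp: edge_graph_def)
  qed
  have eq: "rounds_left st G (?f ` U) {} Alice = rounds_left st ?H U {} Alice" if "U \<subseteq> {..<n}" for U
    using rounds_left_embed[of ?f U "{}" G ?H st Alice] inj_on_subset[OF inj that] adj that by auto
  have V: "verts ?H = {..<n}" by (simp add: edge_graph_def)
  have "rounds_left st G (verts G) {} Alice = 3"
    using eq[of "{..<n}"] assms(4) img V unfolding critical_for_def by simp
  moreover have "rounds_left st G (verts G - {x}) {} Alice \<le> 2" if "x \<in> verts G" for x
  proof -
    obtain i where i: "i < n" "x = ?f i" using \<open>x \<in> verts G\<close> img by auto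
    have "verts G - {x} = ?f ` ({..<n} - {i})"
      using inj_on_image_set_diff[OF inj, of "{..<n}" "{i}"] img i by simp
    then show ?thesis using eq[of "{..<n} - {i}"] assms(4) V i(1) unfolding critical_for_def by simp
  qed
  ultimately show ?thesis unfolding critical_for_def by simp
qed

lemma digraph_iso_with_projD:
  assumes "digraph_iso G (with_proj P)"
  obtains g where "inj_on g (verts G)" "g ` verts G = pverts P" "map_prod g g ` arcs_ends G = parcs P"
proof -
  obtain f where f: "pre_digraph.digraph_isomorphism G f" "with_proj P = app_iso f G"
    using assms unfolding digraph_iso_def by blast
  let ?g = "iso_verts f"
  have "inj_on ?g (verts G)" using f(1) unfolding pre_digraph.digraph_isomorphism_def by simp
  moreover have "pverts P = ?g ` verts G"
    using arg_cong[OF f(2), of verts] by simp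
  moreover have "parcs P = map_prod ?g ?g ` arcs_ends G"
  proof -
    have "parcs P = arcs_ends (app_iso f G)" using f(2)[symmetric] by simp
    also have "\<dots> = map_prod ?g ?g ` arcs_ends G"
      using f(1) unfolding arcs_ends_conv pre_digraph.digraph_isomorphism_def
      by (auto simp: image_image intro!: image_cong)
    finally show ?thesis .
  qed
  ultimately show ?thesis using that by simp
qed

lemma digraph_iso_with_projI:
  assumes "graph G" "inj_on g (verts G)" "g ` verts G = pverts P" "map_prod g g ` arcs_ends G = parcs P"
  shows "digraph_iso G (with_proj P)"
proof -
  interpret graph G by (rule assms(1))
  \<comment> \<open>An isomorphism must also map arcs. Sending an arc to its pair of image endpoints
    is injective because there are no parallel arcs.\<close>
  define f where "f = \<lparr> iso_verts = g, iso_arcs = (\<lambda>a. (g (tail G a), g (head G a))),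
    iso_head = snd, iso_tail = fst \<rparr>"
  have "inj_on (iso_arcs f) (arcs G)"
  proof (rule inj_onI)
    fix a b assume ab: "a \<in> arcs G" "b \<in> arcs G" "iso_arcs f a = iso_arcs f b"
    then have "tail G a = tail G b" "head G a = head G b"
      using inj_onD[OF assms(2)] by (auto simp: f_def)
    then show "a = b" using no_multi_arcs[OF ab(1,2)] by (simp add: arc_to_ends_def)
  qed
  then have "digraph_isomorphism f"
    using assms(2) wf_digraph unfolding digraph_isomorphism_def by (simp add: f_def)
  moreover have "with_proj P = app_iso f G"
  proof -
    have "parcs P = iso_arcs f ` arcs G"
      using assms(4) by (simp add: f_def arcs_ends_conv image_image)
    then show ?thesis using assms(3) by (simp add: with_proj_def app_iso_def f_def)
  qed
  ultimately show ?thesis unfolding digraph_iso_def by blast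
qed

text \<open>Once the target is enumerated by \<open>ys\<close>, an isomorphism amounts to an
  enumeration of G with the same edge positions: pull \<open>ys\<close> back, or match the two lists
  position by position.\<close>

lemma digraph_iso_iff_realizes:
  assumes "graph G" "realizes (with_proj P) ys es" "length ys = n" "proper_edges n es"
  shows "digraph_iso G (with_proj P) \<longleftrightarrow> (\<exists>xs. length xs = n \<and> realizes G xs es)"
proof
  have ys: "distinct ys" "pverts P = set ys" using assms(2) unfolding realizes_def by auto
  have parcs: "parcs P = (\<lambda>(i, j). (ys ! i, ys ! j)) ` (set es \<union> (set es)\<inverse>)"
    using realizes_arcs_ends[OF assms(2)] by simp
  have bound: "i < length ys" "j < length ys" if "(i, j) \<in> set es" for i j
    using that assms(3,4) unfolding proper_edges_def by auto
  interpret graph G by (rule assms(1))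
  {
    assume "digraph_iso G (with_proj P)"
    then obtain g where g: "inj_on g (verts G)" "g ` verts G = pverts P"
      "map_prod g g ` arcs_ends G = parcs P" by (rule digraph_iso_with_projD)
    let ?h = "inv_into (verts G) g"
    let ?xs = "map ?h ys"
    have hinj: "inj_on ?h (set ys)" using inj_on_inv_into[of "set ys" g "verts G"] g(2) ys(2) by simp
    have himg: "?h ` set ys = verts G" using g(1,2) ys(2) by (metis inv_into_image_cancel order_refl)
    have "arcs_ends G = map_prod ?h ?h ` parcs P"
    proof -
      have "map_prod ?h ?h (map_prod g g e) = e" if "e \<in> arcs_ends G" for e
        using that adj_in_verts g(1) by (cases e) auto
      then show ?thesis unfolding g(3)[symmetric] image_image by simp
    qed
    also have "\<dots> = (\<lambda>(i, j). (?xs ! i, ?xs ! j)) ` (set es \<union> (set es)\<inverse>)"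
      unfolding parcs image_image by (intro image_cong) (auto simp: bound)
    finally have "arcs_ends G = (\<lambda>(i, j). (?xs ! i, ?xs ! j)) ` (set es \<union> (set es)\<inverse>)" .
    then have "realizes G ?xs es"
      using ys(1) hinj himg unfolding realizes_def
      by (auto simp: distinct_map Let_def image_iff)
    then show "\<exists>xs. length xs = n \<and> realizes G xs es" using assms(3) by (intro exI[of _ ?xs]) simp
  }
  {
    assume "\<exists>xs. length xs = n \<and> realizes G xs es"
    then obtain xs where len: "length xs = length ys" and "realizes G xs es" using assms(3) by auto
    then have xs: "distinct xs" "verts G = set xs"
      "arcs_ends G = (\<lambda>(i, j). (xs ! i, xs ! j)) ` (set es \<union> (set es)\<inverse>)"
      using realizes_arcs_ends unfolding realizes_def by auto
    define g where "g = (\<lambda>x. the (map_of (zip xs ys) x))"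
    have g: "g (xs ! i) = ys ! i" if "i < length ys" for i
      using that len xs(1) unfolding g_def by (simp add: map_of_zip_nth)
    have "map g xs = ys" using g len by (intro nth_equalityI) auto
    then have "g ` verts G = pverts P" "inj_on g (verts G)"
      using xs(2) ys distinct_map[of g xs] by (metis set_map)+
    moreover have "map_prod g g ` arcs_ends G = parcs P"
      unfolding xs(3) parcs image_image by (intro image_cong) (auto simp: bound g)
    ultimately show "digraph_iso G (with_proj P)" using digraph_iso_with_projI assms(1) by blast
  }
qed

section \<open>The five named graphs in list form\<close>

lemma realizes_cycle3: "realizes (with_proj (cycle_graph 3)) [0, 1, 2] cycle3_edges"
proof -
  have V: "{..<3} = {0, 1, 2 :: nat}" by auto
  have "{(i, Suc i mod 3) | i. i < 3} = (\<lambda>i. (i, Suc i mod 3)) ` {..<3}"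
    unfolding setcompr_eq_image lessThan_def ..
  also have "\<dots> = {(0, 1), (1, 2), (2, 0)}" unfolding V Suc_eq_plus1 by (simp del: One_nat_def)
  finally show ?thesis
    unfolding realizes_def cycle_graph_def cycle3_edges_def Let_def with_proj_simps
      pair_pre_digraph.simps V by simp
qed

lemma realizes_cycle5: "realizes (with_proj (cycle_graph 5)) [0, 1, 2, 3, 4] cycle5_edges"
proof -
  have V: "{..<5} = {0, 1, 2, 3, 4 :: nat}" by auto
  have "{(i, Suc i mod 5) | i. i < 5} = (\<lambda>i. (i, Suc i mod 5)) ` {..<5}"
    unfolding setcompr_eq_image lessThan_def ..
  also have "\<dots> = {(0, 1), (1, 2), (2, 3), (3, 4), (4, 0)}" unfolding V Suc_eq_plus1 by (simp del: One_nat_def)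
  finally show ?thesis
    unfolding realizes_def cycle_graph_def cycle5_edges_def Let_def with_proj_simps
      pair_pre_digraph.simps V by simp
qed

lemma realizes_path6: "realizes (with_proj (path_graph 6)) [0, 1, 2, 3, 4, 5] path6_edges"
proof -
  have V: "{..<6} = {0, 1, 2, 3, 4, 5 :: nat}" and A: "{i. Suc i < 6} = {0, 1, 2, 3, 4}" by auto
  have "{(i, Suc i) | i. Suc i < 6} = (\<lambda>i. (i, Suc i)) ` {i. Suc i < 6}"
    unfolding setcompr_eq_image ..
  also have "\<dots> = {(0, 1), (1, 2), (2, 3), (3, 4), (4, 5)}" unfolding A unfolding Suc_eq_plus1 by (simp del: One_nat_def)
  finally show ?thesis
    unfolding realizes_def path_graph_def path6_edges_def Let_def with_proj_simps
      pair_pre_digraph.simps V by auto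
qed

lemma realizes_sun4:
  "realizes (with_proj (add_pendants (cycle_graph 4)))
    [Inl 0, Inl 1, Inl 2, Inl 3, Inr 0, Inr 1, Inr 2, Inr 3] sun4_edges"
proof -
  have V: "{..<4} = {0, 1, 2, 3 :: nat}" by auto
  have "{(i, Suc i mod 4) | i. i < 4} = (\<lambda>i. (i, Suc i mod 4)) ` {..<4}"
    unfolding setcompr_eq_image lessThan_def ..
  also have "\<dots> = {(0, 1), (1, 2), (2, 3), (3, 0)}" unfolding V Suc_eq_plus1 by (simp del: One_nat_def)
  finally have cycle: "pverts (cycle_graph 4) = {0, 1, 2, 3}"
    "parcs (cycle_graph 4) = {(0, 1), (1, 2), (2, 3), (3, 0), (1, 0), (2, 1), (3, 2), (0, 3)}"
    unfolding cycle_graph_def Let_def pair_pre_digraph.simps V by auto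
  have arcs: "{(Inl u, Inl v) | u v. (u, v) \<in> E} = map_prod Inl Inl ` E"
    and pendants: "{(Inl v, Inr v) | v. v \<in> W} = (\<lambda>v. (Inl v, Inr v)) ` W"
    for E :: "(nat \<times> nat) set" and W :: "nat set" by auto
  have parcs: "parcs (add_pendants (cycle_graph 4)) =
    map_prod Inl Inl ` {(0, 1), (1, 2), (2, 3), (3, 0), (1, 0), (2, 1), (3, 2), (0, 3)} \<union>
    (\<lambda>v. (Inl v, Inr v)) ` {0, 1, 2, 3} \<union> ((\<lambda>v. (Inl v, Inr v)) ` {0, 1, 2, 3})\<inverse>"
    unfolding add_pendants_def Let_def pair_pre_digraph.simps arcs pendants cycle ..
  have pverts: "pverts (add_pendants (cycle_graph 4)) =
    set [Inl 0, Inl 1, Inl 2, Inl 3, Inr 0, Inr 1, Inr 2, Inr 3]"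
    unfolding add_pendants_def Let_def pair_pre_digraph.simps cycle Plus_def by (simp add: insert_commute)
  have converse_insert: "(insert (u, v) R)\<inverse> = insert (v, u) (R\<inverse>)" for u v and R :: "('c \<times> 'c) set"
    by auto
  show ?thesis
    unfolding realizes_def sun4_edges_def Let_def with_proj_simps parcs pverts
    by (intro conjI refl equalityI) (simp_all add: converse_insert)
qed

text \<open>Any perfect matching of K_{3,3} is a bijection between the sides, so the result is C_6
  whichever matching is removed.\<close>

lemma realizes_K33_minus_matching:
  assumes "K\<^bsub>3,3\<^esub> (with_proj H)" "perfect_matching H M"
  shows "\<exists>xs. length xs = 6 \<and> realizes (with_proj (remove_edges H M)) xs cycle6_edges"
proof -
  obtain U V where H: "pverts H = U \<union> V" "U \<inter> V = {}" "card U = 3" "card V = 3"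
    "parcs H = U \<times> V \<union> V \<times> U" and fin: "finite (pverts H)"
    using assms(1) unfolding complete_bipartite_digraph_pair_def by blast
  have M: "M \<subseteq> parcs H" "sym M" "\<And>v. v \<in> pverts H \<Longrightarrow> \<exists>!w. (v, w) \<in> M"
    using assms(2) unfolding perfect_matching_def by auto
  let ?D = "remove_edges H M"
  have D: "pverts ?D = pverts H" "parcs ?D = parcs H - M" unfolding remove_edges_def by simp_all
  define m where "m v = (THE w. (v, w) \<in> M)" for v
  have m: "(v, w) \<in> M \<longleftrightarrow> w = m v" if "v \<in> pverts H" for v w
    using M(3)[OF that] theI'[OF M(3)[OF that]] unfolding m_def by blast
  have mU: "m u \<in> V" if "u \<in> U" for u
  proof -
    have "(u, m u) \<in> M" using m[of u "m u"] that H(1) by simp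
    then show ?thesis using M(1) H(2,5) that by blast
  qed
  have "m (m u) = u" if "u \<in> U" for u
  proof -
    have "(u, m u) \<in> M" using m[of u "m u"] that H(1) by simp
    then have "(m u, u) \<in> M" using M(2) by (rule symD[rotated])
    then show ?thesis using m[of "m u" u] mU[OF that] H(1) by simp
  qed
  then have "inj_on m U" by (rule inj_on_inverseI)
  moreover have "m ` U = V"
  proof (rule card_subset_eq)
    show "finite V" using H(1) fin by simp
    show "card (m ` U) = card V" using card_image[OF \<open>inj_on m U\<close>] H(3,4) by simp
  qed (use mU in blast)
  ultimately have bij: "bij_betw m U V" unfolding bij_betw_def by simp
  have graph: "graph (with_proj ?D)"
  proof unfold_locales
    have "finite (parcs H)" using H fin by simp
    then show "finite (arcs (with_proj ?D))" using D by simp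
    show "symmetric (with_proj ?D)"
      using D H(5) M(2) unfolding symmetric_def sym_def by auto
  next
    fix e assume "e \<in> arcs (with_proj ?D)"
    then have "e \<in> U \<times> V \<union> V \<times> U" using D H(5) by auto
    then show "tail (with_proj ?D) e \<in> verts (with_proj ?D)" "head (with_proj ?D) e \<in> verts (with_proj ?D)"
      "tail (with_proj ?D) e \<noteq> head (with_proj ?D) e"
      using D H(1,2) by auto
  qed (use D fin in \<open>simp_all add: arc_to_ends_def\<close>)
  interpret D: bipartition "with_proj ?D" U V
  proof (intro bipartition.intro bipartition_axioms.intro graph)
    show "graph.indep (with_proj ?D) U" "graph.indep (with_proj ?D) V"
      unfolding graph.indep_def[OF graph] using D H(2,5) by auto
  qed (use D H in simp_all)
  have "card U = 3" by (fact H(3))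
  moreover have "u \<rightarrow>\<^bsub>with_proj ?D\<^esub> v \<longleftrightarrow> v \<noteq> m u" if "u \<in> U" "v \<in> V" for u v
    using that m[of u v] D H(1,5) by auto
  ultimately show ?thesis using D.mirror_realizes_cycle6[OF _ bij] by simp
qed

lemma K33_minus_matching_exists:
  "\<exists>(H :: nat pair_pre_digraph) M. K\<^bsub>3,3\<^esub> (with_proj H) \<and> perfect_matching H M \<and>
    realizes (with_proj (remove_edges H M)) [0, 1, 2, 3, 4, 5] cycle6_edges"
proof -
  define U V :: "nat set" where "U = {0, 2, 4}" and "V = {1, 3, 5}"
  define H where "H = \<lparr> pverts = U \<union> V, parcs = U \<times> V \<union> V \<times> U \<rparr>"
  \<comment> \<open>On the hexagon 0, ..., 5 with even and odd sides, the antipodal pairs are the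
    missing edges.\<close>
  define M :: "(nat \<times> nat) set" where "M = {(0, 3), (3, 0), (2, 5), (5, 2), (4, 1), (1, 4)}"
  have "K\<^bsub>3,3\<^esub> (with_proj H)"
    unfolding complete_bipartite_digraph_pair_def
  proof (intro conjI exI)
    show "pverts H = U \<union> V" "parcs H = U \<times> V \<union> V \<times> U" unfolding H_def by simp_all
  qed (simp_all add: H_def U_def V_def)
  moreover have "perfect_matching H M"
    unfolding perfect_matching_def
  proof (intro conjI)
    show "M \<subseteq> parcs H" "sym M" by (auto simp: M_def H_def U_def V_def sym_def)
    show "\<forall>v \<in> pverts H. \<exists>!w. (v, w) \<in> M" by (simp add: M_def H_def U_def V_def)
  qed
  moreover have "realizes (with_proj (remove_edges H M)) [0, 1, 2, 3, 4, 5] cycle6_edges"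
  proof -
    have "parcs H - M = {(0, 1), (0, 5), (2, 1), (2, 3), (4, 3), (4, 5),
      (1, 0), (5, 0), (1, 2), (3, 2), (3, 4), (5, 4)}"
      by (auto simp: M_def H_def U_def V_def)
    then show ?thesis
      unfolding realizes_def remove_edges_def cycle6_edges_def Let_def
      by (auto simp: H_def U_def V_def)
  qed
  ultimately show ?thesis by blast
qed

section \<open>Return to the original formulation\<close>

lemma (in graph) conn_if_connected:
  assumes "connected G" shows "conn (verts G)"
  unfolding conn_def
proof (intro allI impI)
  fix X assume X: "X \<subseteq> verts G" "X \<noteq> {}" "\<forall>u \<in> X. \<forall>v \<in> verts G. u \<rightarrow> v \<longrightarrow> v \<in> X"
  have sc: "strongly_connected G"
    using symmetric_connected_imp_strongly_connected[OF sym_arcs assms] .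
  obtain u where u: "u \<in> X" using X(2) by blast
  have "v \<in> X" if "v \<in> verts G" for v
  proof -
    have "u \<rightarrow>\<^sup>* v" using sc u X(1) that by auto
    then show ?thesis
    proof (induction rule: reachable_induct)
      case (step x y)
      then show ?case using X(3) adj_in_verts(2) by blast
    qed (rule u)
  qed
  then show "X = verts G" using X(1) by blast
qed

lemma lower_game_vertex_critical_iff:
  "lower_game_vertex_critical 3 chi_igA G \<longleftrightarrow> critical_for (\<lambda>_. Alice) G"
  "lower_game_vertex_critical 3 chi_igAB G \<longleftrightarrow> critical_for opponent G"
proof -
  have del: "rounds_left st (pre_digraph.del_vert G x) (verts G - {x}) {} Alice =
    rounds_left st G (verts G - {x}) {} Alice" for st x
  proof -
    have "u \<rightarrow>\<^bsub>G\<^esub> v \<longleftrightarrow> u \<rightarrow>\<^bsub>pre_digraph.del_vert G x\<^esub> v" if "u \<noteq> x" "v \<noteq> x" for u v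
      using that by (auto simp: arcs_ends_conv pre_digraph.del_vert_def)
    then show ?thesis
      using rounds_left_embed[of id "verts G - {x}" "{}" "pre_digraph.del_vert G x" G st Alice] by simp
  qed
  have verts: "verts (pre_digraph.del_vert G x) = verts G - {x}" for x
    by (simp add: pre_digraph.del_vert_def)
  have less: "n < 3 \<longleftrightarrow> n \<le> 2" for n :: nat by auto
  show "lower_game_vertex_critical 3 chi_igA G \<longleftrightarrow> critical_for (\<lambda>_. Alice) G"
    "lower_game_vertex_critical 3 chi_igAB G \<longleftrightarrow> critical_for opponent G"
    unfolding lower_game_vertex_critical_def critical_for_def chi_igA_def chi_igAB_def
      verts del by (auto simp: less)
qed

theorem theorem24:
  fixes G :: "('a, 'b) pre_digraph"
  assumes "graph G" and "connected G"
  shows "\<forall>\<phi> \<in> {chi_igA, chi_igAB}.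
    lower_game_vertex_critical 3 \<phi> G \<longleftrightarrow>
      digraph_iso G (with_proj (cycle_graph 3)) \<or>
      digraph_iso G (with_proj (cycle_graph 5)) \<or>
      digraph_iso G (with_proj (path_graph 6)) \<or>
      (\<exists>(H :: nat pair_pre_digraph) M. K\<^bsub>3,3\<^esub> (with_proj H) \<and> perfect_matching H M \<and>
         digraph_iso G (with_proj (remove_edges H M))) \<or>
      digraph_iso G (with_proj (add_pendants (cycle_graph 4)))"
proof -
  interpret graph G by (rule assms(1))
  let ?R = "\<lambda>n es. \<exists>xs. length xs = n \<and> realizes G xs es"
  have proper: "proper_edges 3 cycle3_edges" "proper_edges 5 cycle5_edges" "proper_edges 6 path6_edges"
    "proper_edges 6 cycle6_edges" "proper_edges 8 sun4_edges"
    by (simp_all add: proper_edges_def edge_lists)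
  have iso:
    "digraph_iso G (with_proj (cycle_graph 3)) \<longleftrightarrow> ?R 3 cycle3_edges"
    "digraph_iso G (with_proj (cycle_graph 5)) \<longleftrightarrow> ?R 5 cycle5_edges"
    "digraph_iso G (with_proj (path_graph 6)) \<longleftrightarrow> ?R 6 path6_edges"
    "digraph_iso G (with_proj (add_pendants (cycle_graph 4))) \<longleftrightarrow> ?R 8 sun4_edges"
    by (rule digraph_iso_iff_realizes[OF assms(1) realizes_cycle3 _ proper(1)]
        digraph_iso_iff_realizes[OF assms(1) realizes_cycle5 _ proper(2)]
        digraph_iso_iff_realizes[OF assms(1) realizes_path6 _ proper(3)]
        digraph_iso_iff_realizes[OF assms(1) realizes_sun4 _ proper(5)]; simp)+
  \<comment> \<open>The matching is existentially quantified, so one direction needs the list form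
    for every choice and the other needs one concrete choice.\<close>
  have K33: "(\<exists>(H :: nat pair_pre_digraph) M. K\<^bsub>3,3\<^esub> (with_proj H) \<and> perfect_matching H M \<and>
      digraph_iso G (with_proj (remove_edges H M))) \<longleftrightarrow> ?R 6 cycle6_edges"
  proof
    assume "\<exists>(H :: nat pair_pre_digraph) M. K\<^bsub>3,3\<^esub> (with_proj H) \<and> perfect_matching H M \<and>
      digraph_iso G (with_proj (remove_edges H M))"
    then obtain H :: "nat pair_pre_digraph" and M where H: "K\<^bsub>3,3\<^esub> (with_proj H)"
      "perfect_matching H M" "digraph_iso G (with_proj (remove_edges H M))" by blast
    then obtain ys where "length ys = 6" "realizes (with_proj (remove_edges H M)) ys cycle6_edges"
      using realizes_K33_minus_matching by blast
    then show "?R 6 cycle6_edges"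
      using digraph_iso_iff_realizes[OF assms(1), of "remove_edges H M" ys] H(3) proper(4) by auto
  next
    assume R: "?R 6 cycle6_edges"
    obtain H :: "nat pair_pre_digraph" and M where H: "K\<^bsub>3,3\<^esub> (with_proj H)" "perfect_matching H M"
      "realizes (with_proj (remove_edges H M)) [0, 1, 2, 3, 4, 5] cycle6_edges"
      using K33_minus_matching_exists by blast
    then have "digraph_iso G (with_proj (remove_edges H M))"
      using digraph_iso_iff_realizes[OF assms(1) H(3) _ proper(4)] R by simp
    then show "\<exists>(H :: nat pair_pre_digraph) M. K\<^bsub>3,3\<^esub> (with_proj H) \<and> perfect_matching H M \<and>
      digraph_iso G (with_proj (remove_edges H M))" using H by blast
  qed
  have main: "critical_for st G \<longleftrightarrow>
      ?R 3 cycle3_edges \<or> ?R 5 cycle5_edges \<or> ?R 6 path6_edges \<or> ?R 6 cycle6_edges \<or> ?R 8 sun4_edges"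
    if st: "st Bob = Alice" for st
  proof
    assume crit: "critical_for st G"
    show "?R 3 cycle3_edges \<or> ?R 5 cycle5_edges \<or> ?R 6 path6_edges \<or> ?R 6 cycle6_edges \<or>
      ?R 8 sun4_edges"
    proof (rule critical_classification)
      show "conn (verts G)" by (rule conn_if_connected[OF assms(2)])
      show "st Bob = Alice" by (rule st)
      show "rounds_left st G (verts G) {} Alice = 3" using crit unfolding critical_for_def by blast
      show "rounds_left st G (verts G - {x}) {} Alice \<le> 2" if "x \<in> verts G" for x
        using crit that unfolding critical_for_def by blast
    qed
  next
    assume "?R 3 cycle3_edges \<or> ?R 5 cycle5_edges \<or> ?R 6 path6_edges \<or> ?R 6 cycle6_edges \<or>
      ?R 8 sun4_edges"
    then show "critical_for st G"
      using critical_for_if_realizes[OF _ _ proper(1) critical_edge_graphs(1)]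
        critical_for_if_realizes[OF _ _ proper(2) critical_edge_graphs(2)]
        critical_for_if_realizes[OF _ _ proper(3) critical_edge_graphs(3)]
        critical_for_if_realizes[OF _ _ proper(4) critical_edge_graphs(4)]
        critical_for_if_realizes[OF _ _ proper(5) critical_edge_graphs(5)]
      by blast
  qed
  have "opponent Bob = Alice" by simp
  then show ?thesis
    unfolding iso K33 using main[of opponent] main[of "\<lambda>_. Alice"]
    by (simp only: ball_simps lower_game_vertex_critical_iff insert_iff HOL.simp_thms)
qed

end
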